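(* Let $M$ be an almost Fuchsian (non-Fuchsian) 3-manifold, let $S\subset M$ be its minimal surface with principal curvatures $\pm\lambda(z)$, $0\le\lambda(z)<1$, $z\in S$, and let $\{S(r)\}_{r\in\mathbb{R}}$ be the foliation of $M$ by surfaces parallel to $S$. Let $\lambda_0=\max\{\lambda(z): z\in S\}$ be the maximal principal curvature on $S$. Then for all $r,r_1,r_2\in(-\infty,\infty)$, $$d_T(S,S(r))\le\frac12\left|\log\frac{1+\lambda_0\tanh(r)}{1-\lambda_0\tanh(r)}\right|,$$ $$d_T(S(r_1),S(r_2))\le\frac12\left|\log\frac{1+\lambda_0\tanh(r_2)}{1-\lambda_0\tanh(r_2)}-\log\frac{1+\lambda_0\tanh(r_1)}{1-\lambda_0\tanh(r_1)}\right|,$$ where $d_T$ is the Teichmüller distance.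
   Context: $\Sigma$ is a closed oriented surface of genus $g\ge 2$; $\mathcal{T}_g(\Sigma)$ is its Teichmüller space. The Teichmüller distance is $d_T((\Sigma,\sigma_1),(\Sigma,\sigma_2))=\frac12\log\inf_f K[f]$, where $f:(\Sigma,\sigma_1)\to(\Sigma,\sigma_2)$ ranges over quasiconformal maps homotopic to the identity and $K[f]$ is the maximal dilatation of $f$. A finitely generated torsion-free Kleinian group $\Gamma\subset PSL(2,\mathbb{C})$ (assumed without parabolic elements) is quasi-Fuchsian if its limit set $\Lambda_\Gamma\subset S^2_\infty=\partial\mathbb{H}^3$ is a closed Jordan curve and both components $\Omega_\pm$ of $S^2_\infty\setminus\Lambda_\Gamma$ are $\Gamma$-invariant; it is Fuchsian if $\Lambda_\Gamma$ is a circle. The quotient $M=\mathbb{H}^3/\Gamma\cong\Sigma\times\mathbb{R}$ is then a quasi-Fuchsian 3-manifold. Throughout, $M$ is not Fuchsian. A quasi-Fuchsian 3-manifold $M$ is almost Fuchsian if it contains a (unique) closed embedded incompressible minimal surface $S$, representing the fundamental group, whose principal curvatures all lie in $(-1,1)$. Since $S$ is minimal, its principal curvatures at $z$ are $\lambda(z)$ and $-\lambda(z)$ with $\lambda(z)\ge0$. Let $\nu$ be a unit normal field on $S$. For $r\in\mathbb{R}$ the parallel surface is $S(r)=\{\exp_x(r\nu(x)) : x\in S\}$. By a theorem of Uhlenbeck, $(x,r)\mapsto\exp_x(r\nu(x))$ is a diffeomorphism $S\times\mathbb{R}\to M$, so $\{S(r)\}_{r\in\mathbb{R}}$ is a foliation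 of $M$, with $S(0)=S$. $S$ and $S(r)$ are regarded as points of $\mathcal{T}_g(\Sigma)$: $S$ is identified with $\Sigma$ (in the homotopy class given by $M\cong\Sigma\times\mathbb{R}$), $S(r)$ is identified with $S$ by $x\mapsto\exp_x(r\nu(x))$, and each carries the conformal structure of the Riemannian metric induced from $M$. *)

theory Defs
  imports "HOL-Analysis.Analysis" "HOL-Homology.Homology"
begin

section \<open>Smooth maps\<close>

primrec Ck_on :: "nat \<Rightarrow> ('a::euclidean_space \<Rightarrow> 'b::real_normed_vector) \<Rightarrow> 'a set \<Rightarrow> bool"
  where
    "Ck_on 0 f U \<longleftrightarrow> continuous_on U f"
  | "Ck_on (Suc k) f U \<longleftrightarrow> (\<forall>x\<in>U. f differentiable (at x)) \<and>
        (\<forall>v. Ck_on k (\<lambda>x. frechet_derivative f (at x) v) U)"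

text \<open>Only used for open \<open>U\<close>.\<close>

definition smooth_map_on :: "'a::euclidean_space set \<Rightarrow> ('a \<Rightarrow> 'b::real_normed_vector) \<Rightarrow> bool"
  where "smooth_map_on U f \<longleftrightarrow> (\<forall>k. Ck_on k f U)"


section \<open>Hyperbolic 3-space and its isometries\<close>

text \<open>
  Minkowski space is the real 4-dimensional space of Hermitian 2 by 2 matrices with the quadratic
  form \<open>- det\<close>, which has signature (3,1), and hyperbolic 3-space is the hyperboloid of positive
  definite matrices of determinant 1 with the induced Riemannian metric (curvature -1). A matrix
  \<open>A\<close> in SL(2,C) acts by \<open>X \<mapsto> A X A\<^sup>*\<close>. The polar form of \<open>- det\<close> is
  \<open>(tr (X Y) - tr X tr Y) / 2\<close>.
\<close>

type_synonym mat2 = "complex ^ 2 ^ 2"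

definition adj :: "mat2 \<Rightarrow> mat2"
  where "adj A = (\<chi> i j. cnj (A $ j $ i))"

definition hermitian :: "mat2 \<Rightarrow> bool"
  where "hermitian X \<longleftrightarrow> adj X = X"

definition mink :: "mat2 \<Rightarrow> mat2 \<Rightarrow> real"
  where "mink X Y = Re (trace (X ** Y) - trace X * trace Y) / 2"

definition H3 :: "mat2 set"
  where "H3 = {X. hermitian X \<and> det X = 1 \<and> Re (trace X) > 0}"

definition H3_tangent :: "mat2 \<Rightarrow> mat2 set"
  where "H3_tangent p = {v. hermitian v \<and> mink p v = 0}"

text \<open>
  The Levi-Civita connection of the hyperboloid is the tangential part of the flat derivative, so
  a curve in it is a geodesic iff its second derivative is normal, i.e. a multiple of the position
  vector; differentiating \<open>mink c c = -1\<close> twice gives the factor \<open>mink c' c'\<close>.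
\<close>

definition geodesic :: "(real \<Rightarrow> mat2) \<Rightarrow> (real \<Rightarrow> mat2) \<Rightarrow> bool"
  where "geodesic c c' \<longleftrightarrow> (\<forall>t. c t \<in> H3 \<and> (c has_vector_derivative c' t) (at t) \<and>
     (c' has_vector_derivative mink (c' t) (c' t) *\<^sub>R c t) (at t))"

definition hexp :: "mat2 \<Rightarrow> mat2 \<Rightarrow> mat2"
  where "hexp p v = (THE q. \<exists>c c'. geodesic c c' \<and> c 0 = p \<and> c' 0 = v \<and> c 1 = q)"

text \<open>
  PSL(2,C) is taken as the group of transformations \<open>X \<mapsto> A X A\<^sup>*\<close>; two matrices of determinant 1
  give the same transformation iff they agree up to sign.
\<close>

definition SL2C :: "mat2 set"
  where "SL2C = {A. det A = 1}"

definition moebius :: "mat2 \<Rightarrow> mat2 \<Rightarrow> mat2"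
  where "moebius A X = A ** X ** adj A"

definition PSL2C :: "(mat2 \<Rightarrow> mat2) monoid"
  where "PSL2C = \<lparr>carrier = moebius ` SL2C, mult = (\<circ>), one = id\<rparr>"

text \<open>
  Rescaling to trace 1 maps the hyperboloid to the interior of the ball of positive semidefinite
  matrices of trace 1 (the projective model). The boundary sphere consists of the orthogonal
  projections onto the lines in \<open>\<complex>\<^sup>2\<close>, i.e. it is the complex projective line, and it is
  a round sphere of diameter \<open>sqrt 2\<close> for the Euclidean (Frobenius) distance, conformally
  equivalent to the Riemann sphere.
\<close>

definition sphere_inf :: "mat2 set"
  where "sphere_inf = {Y. hermitian Y \<and> det Y = 0 \<and> trace Y = 1}"

definition normalize_trace :: "mat2 \<Rightarrow> mat2"
  where "normalize_trace X = (1 / Re (trace X)) *\<^sub>R X"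

definition boundary_action :: "(mat2 \<Rightarrow> mat2) \<Rightarrow> mat2 \<Rightarrow> mat2"
  where "boundary_action \<gamma> Y = normalize_trace (\<gamma> Y)"

definition round_circle :: "mat2 set \<Rightarrow> bool"
  where "round_circle C \<longleftrightarrow>
    (\<exists>P\<in>sphere_inf. \<exists>\<rho>. 0 < \<rho> \<and> \<rho> < sqrt 2 \<and> C = {Y \<in> sphere_inf. dist P Y = \<rho>})"

definition jordan_curve :: "mat2 set \<Rightarrow> bool"
  where "jordan_curve C \<longleftrightarrow>
    (\<exists>c. simple_path c \<and> pathfinish c = pathstart c \<and> path_image c = C)"


section \<open>Kleinian and quasi-Fuchsian groups\<close>

definition kleinian :: "(mat2 \<Rightarrow> mat2) set \<Rightarrow> bool"
  where "kleinian \<Gamma> \<longleftrightarrow> subgroup \<Gamma> PSL2C \<and> discrete {A \<in> SL2C. moebius A \<in> \<Gamma>}"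

definition finitely_generated :: "(mat2 \<Rightarrow> mat2) set \<Rightarrow> bool"
  where "finitely_generated \<Gamma> \<longleftrightarrow> (\<exists>F. finite F \<and> F \<subseteq> \<Gamma> \<and> generate PSL2C F = \<Gamma>)"

definition torsion_free :: "(mat2 \<Rightarrow> mat2) set \<Rightarrow> bool"
  where "torsion_free \<Gamma> \<longleftrightarrow>
    (\<forall>\<gamma>\<in>\<Gamma>. \<forall>n::nat. n > 0 \<longrightarrow> \<gamma> [^]\<^bsub>PSL2C\<^esub> n = \<one>\<^bsub>PSL2C\<^esub> \<longrightarrow> \<gamma> = \<one>\<^bsub>PSL2C\<^esub>)"

definition no_parabolics :: "(mat2 \<Rightarrow> mat2) set \<Rightarrow> bool"
  where "no_parabolics \<Gamma> \<longleftrightarrow>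
    (\<forall>A\<in>SL2C. moebius A \<in> \<Gamma> \<longrightarrow> (trace A)\<^sup>2 = 4 \<longrightarrow> moebius A = \<one>\<^bsub>PSL2C\<^esub>)"

definition limit_set :: "(mat2 \<Rightarrow> mat2) set \<Rightarrow> mat2 set"
  where "limit_set \<Gamma> =
    {Y \<in> sphere_inf. \<exists>x\<in>H3. Y islimpt ((\<lambda>\<gamma>. normalize_trace (\<gamma> x)) ` \<Gamma>)}"

definition quasi_fuchsian :: "(mat2 \<Rightarrow> mat2) set \<Rightarrow> bool"
  where "quasi_fuchsian \<Gamma> \<longleftrightarrow>
    kleinian \<Gamma> \<and> finitely_generated \<Gamma> \<and> torsion_free \<Gamma> \<and> no_parabolics \<Gamma> \<and>
    jordan_curve (limit_set \<Gamma>) \<and>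
    (\<forall>\<Omega>\<in>components (sphere_inf - limit_set \<Gamma>). \<forall>\<gamma>\<in>\<Gamma>. boundary_action \<gamma> ` \<Omega> = \<Omega>)"

definition fuchsian :: "(mat2 \<Rightarrow> mat2) set \<Rightarrow> bool"
  where "fuchsian \<Gamma> \<longleftrightarrow> quasi_fuchsian \<Gamma> \<and> round_circle (limit_set \<Gamma>)"


section \<open>The quotient 3-manifold\<close>

definition orbit_of :: "(mat2 \<Rightarrow> mat2) set \<Rightarrow> mat2 \<Rightarrow> mat2 set"
  where "orbit_of \<Gamma> x = (\<lambda>\<gamma>. \<gamma> x) ` \<Gamma>"

text \<open>The points of \<open>M = H3 / \<Gamma>\<close> are the \<open>\<Gamma>\<close>-orbits in \<open>H3\<close>, with the quotient topology.\<close>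

definition hyp_quotient :: "(mat2 \<Rightarrow> mat2) set \<Rightarrow> mat2 set topology"
  where "hyp_quotient \<Gamma> = topology (\<lambda>U. U \<subseteq> orbit_of \<Gamma> ` H3 \<and>
    openin (top_of_set H3) {x \<in> H3. orbit_of \<Gamma> x \<in> U})"

definition preimage_in_H3 :: "(mat2 \<Rightarrow> mat2) set \<Rightarrow> mat2 set set \<Rightarrow> mat2 set"
  where "preimage_in_H3 \<Gamma> S = {x \<in> H3. orbit_of \<Gamma> x \<in> S}"

text \<open>
  The projection \<open>H3 \<rightarrow> M\<close> is a local isometry, so the local differential geometry of \<open>M\<close> is
  expressed through local lifts to \<open>H3\<close>; planar domains are open subsets of \<open>\<complex>\<close>.
\<close>

definition local_lift ::
    "(mat2 \<Rightarrow> mat2) set \<Rightarrow> (complex \<Rightarrow> mat2 set) \<Rightarrow> complex set \<Rightarrow> (complex \<Rightarrow> mat2) \<Rightarrow> bool"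
  where "local_lift \<Gamma> G V Y \<longleftrightarrow> open V \<and> smooth_map_on V Y \<and>
    (\<forall>w\<in>V. Y w \<in> H3 \<and> orbit_of \<Gamma> (Y w) = G w)"

definition immersive_at :: "(complex \<Rightarrow> mat2) \<Rightarrow> complex \<Rightarrow> bool"
  where "immersive_at Y w \<longleftrightarrow> inj (frechet_derivative Y (at w))"

definition conformal_at :: "(complex \<Rightarrow> mat2) \<Rightarrow> complex \<Rightarrow> bool"
  where "conformal_at Y w \<longleftrightarrow> (let D = frechet_derivative Y (at w) in
    mink (D 1) (D 1) = mink (D \<i>) (D \<i>) \<and> mink (D 1) (D 1) > 0 \<and> mink (D 1) (D \<i>) = 0)"

definition immersion_to_quotient ::
    "(mat2 \<Rightarrow> mat2) set \<Rightarrow> complex set \<Rightarrow> (complex \<Rightarrow> mat2 set) \<Rightarrow> bool"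
  where "immersion_to_quotient \<Gamma> W G \<longleftrightarrow>
    (\<forall>z\<in>W. \<exists>V Y. z \<in> V \<and> V \<subseteq> W \<and> local_lift \<Gamma> G V Y \<and> (\<forall>w\<in>V. immersive_at Y w))"

definition conformal_immersion_to_quotient ::
    "(mat2 \<Rightarrow> mat2) set \<Rightarrow> complex set \<Rightarrow> (complex \<Rightarrow> mat2 set) \<Rightarrow> bool"
  where "conformal_immersion_to_quotient \<Gamma> W G \<longleftrightarrow>
    (\<forall>z\<in>W. \<exists>V Y. z \<in> V \<and> V \<subseteq> W \<and> local_lift \<Gamma> G V Y \<and> (\<forall>w\<in>V. conformal_at Y w))"


section \<open>Surfaces in the quotient\<close>

text \<open>A surface \<open>S\<close> in \<open>M\<close> is treated through its \<open>\<Gamma>\<close>-invariant preimage \<open>St\<close> in \<open>H3\<close>.\<close>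

definition local_param :: "mat2 set \<Rightarrow> complex set \<Rightarrow> (complex \<Rightarrow> mat2) \<Rightarrow> bool"
  where "local_param St V X \<longleftrightarrow> open V \<and> smooth_map_on V X \<and> (\<forall>z\<in>V. immersive_at X z) \<and>
    openin (top_of_set St) (X ` V) \<and> (\<exists>Y. homeomorphism V (X ` V) X Y)"

definition embedded_surface :: "(mat2 \<Rightarrow> mat2) set \<Rightarrow> mat2 set set \<Rightarrow> bool"
  where "embedded_surface \<Gamma> S \<longleftrightarrow> S \<subseteq> topspace (hyp_quotient \<Gamma>) \<and>
    (\<forall>p\<in>preimage_in_H3 \<Gamma> S. \<exists>V X. local_param (preimage_in_H3 \<Gamma> S) V X \<and> p \<in> X ` V)"

definition closed_embedded_surface :: "(mat2 \<Rightarrow> mat2) set \<Rightarrow> mat2 set set \<Rightarrow> bool"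
  where "closed_embedded_surface \<Gamma> S \<longleftrightarrow> embedded_surface \<Gamma> S \<and> S \<noteq> {} \<and>
    compactin (hyp_quotient \<Gamma>) S \<and> connectedin (hyp_quotient \<Gamma>) S"

text \<open>A unit normal field on \<open>S\<close> is a \<open>\<Gamma>\<close>-equivariant one on the preimage (the elements of \<open>\<Gamma>\<close>
  are linear maps, hence equal to their differentials).\<close>

definition unit_normal_field ::
    "(mat2 \<Rightarrow> mat2) set \<Rightarrow> mat2 set set \<Rightarrow> (mat2 \<Rightarrow> mat2) \<Rightarrow> bool"
  where "unit_normal_field \<Gamma> S \<nu> \<longleftrightarrow> (let St = preimage_in_H3 \<Gamma> S in
    (\<forall>p\<in>St. \<nu> p \<in> H3_tangent p \<and> mink (\<nu> p) (\<nu> p) = 1) \<and>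
    (\<forall>p\<in>St. \<forall>\<gamma>\<in>\<Gamma>. \<nu> (\<gamma> p) = \<gamma> (\<nu> p)) \<and>
    (\<forall>V X. local_param St V X \<longrightarrow> smooth_map_on V (\<nu> \<circ> X) \<and>
       (\<forall>z\<in>V. \<forall>w. mink (\<nu> (X z)) (frechet_derivative X (at z) w) = 0)))"

text \<open>
  Since \<open>\<nu>\<close> is orthogonal to \<open>p\<close> and to the surface, its flat derivative along the surface is
  tangent to the hyperboloid, hence equal to its covariant derivative. So the shape operator is
  \<open>dX w \<mapsto> - d(\<nu> \<circ> X) w\<close>.
\<close>

definition principal_curvatures ::
    "(mat2 \<Rightarrow> mat2) set \<Rightarrow> mat2 set set \<Rightarrow> (mat2 \<Rightarrow> mat2) \<Rightarrow> mat2 \<Rightarrow> real set"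
  where "principal_curvatures \<Gamma> S \<nu> p =
    {k. \<exists>V X z w. local_param (preimage_in_H3 \<Gamma> S) V X \<and> z \<in> V \<and> X z = p \<and> w \<noteq> 0 \<and>
        - frechet_derivative (\<nu> \<circ> X) (at z) w = k *\<^sub>R frechet_derivative X (at z) w}"

definition mean_curvature_at :: "(mat2 \<Rightarrow> mat2) \<Rightarrow> (complex \<Rightarrow> mat2) \<Rightarrow> complex \<Rightarrow> real"
  where "mean_curvature_at \<nu> X z =
   (let D = frechet_derivative X (at z); N = frechet_derivative (\<nu> \<circ> X) (at z);
        g = (\<lambda>v w. mink (D v) (D w)); b = (\<lambda>v w. - mink (N v) (D w))
    in (b 1 1 * g \<i> \<i> - 2 * b 1 \<i> * g 1 \<i> + b \<i> \<i> * g 1 1)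
         / (2 * (g 1 1 * g \<i> \<i> - (g 1 \<i>)\<^sup>2)))"

definition minimal_surface ::
    "(mat2 \<Rightarrow> mat2) set \<Rightarrow> mat2 set set \<Rightarrow> (mat2 \<Rightarrow> mat2) \<Rightarrow> bool"
  where "minimal_surface \<Gamma> S \<nu> \<longleftrightarrow>
    (\<forall>V X. local_param (preimage_in_H3 \<Gamma> S) V X \<longrightarrow> (\<forall>z\<in>V. mean_curvature_at \<nu> X z = 0))"

definition loop_at :: "'a topology \<Rightarrow> 'a \<Rightarrow> (real \<Rightarrow> 'a) \<Rightarrow> bool"
  where "loop_at X x c \<longleftrightarrow> pathin X c \<and> c 0 = x \<and> c 1 = x"

definition loop_homotopic :: "'a topology \<Rightarrow> 'a \<Rightarrow> (real \<Rightarrow> 'a) \<Rightarrow> (real \<Rightarrow> 'a) \<Rightarrow> bool"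
  where "loop_homotopic X x c d \<longleftrightarrow>
    homotopic_with (\<lambda>e. e 0 = x \<and> e 1 = x) (top_of_set {0..1}) X c d"

text \<open>Injectivity and surjectivity of the map of fundamental groups induced by the inclusion.\<close>

definition incompressible :: "'a topology \<Rightarrow> 'a set \<Rightarrow> bool"
  where "incompressible M S \<longleftrightarrow>
    (\<forall>x\<in>S. \<forall>c. loop_at (subtopology M S) x c \<longrightarrow> loop_homotopic M x c (\<lambda>_. x) \<longrightarrow>
       loop_homotopic (subtopology M S) x c (\<lambda>_. x))"

definition represents_fundamental_group :: "'a topology \<Rightarrow> 'a set \<Rightarrow> bool"
  where "represents_fundamental_group M S \<longleftrightarrow> incompressible M S \<and>
    (\<forall>x\<in>S. \<forall>c. loop_at M x c \<longrightarrow>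
       (\<exists>d. loop_at (subtopology M S) x d \<and> loop_homotopic M x c d))"

definition almost_fuchsian_surface ::
    "(mat2 \<Rightarrow> mat2) set \<Rightarrow> mat2 set set \<Rightarrow> (mat2 \<Rightarrow> mat2) \<Rightarrow> bool"
  where "almost_fuchsian_surface \<Gamma> S \<nu> \<longleftrightarrow>
    closed_embedded_surface \<Gamma> S \<and> incompressible (hyp_quotient \<Gamma>) S \<and>
    represents_fundamental_group (hyp_quotient \<Gamma>) S \<and>
    unit_normal_field \<Gamma> S \<nu> \<and> minimal_surface \<Gamma> S \<nu> \<and>
    (\<forall>p\<in>preimage_in_H3 \<Gamma> S. principal_curvatures \<Gamma> S \<nu> p \<subseteq> {-1<..<1})"

definition almost_fuchsian :: "(mat2 \<Rightarrow> mat2) set \<Rightarrow> bool"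
  where "almost_fuchsian \<Gamma> \<longleftrightarrow> quasi_fuchsian \<Gamma> \<and> (\<exists>S \<nu>. almost_fuchsian_surface \<Gamma> S \<nu>)"

text \<open>The identification of \<open>S\<close> with the parallel surface \<open>S(r) = parallel_map \<nu> r ` S\<close>. A point of \<open>S\<close> is an orbit in the preimage, which the
  equivariant map \<open>x \<mapsto> exp\<^sub>x (r \<nu> x)\<close> takes to an orbit.\<close>

definition parallel_map :: "(mat2 \<Rightarrow> mat2) \<Rightarrow> real \<Rightarrow> mat2 set \<Rightarrow> mat2 set"
  where "parallel_map \<nu> r m = (\<lambda>x. hexp x (r *\<^sub>R \<nu> x)) ` m"


section \<open>Closed oriented surfaces and induced conformal structures\<close>

type_synonym 'a chart = "'a set \<times> ('a \<Rightarrow> complex)"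

definition is_chart :: "'a topology \<Rightarrow> 'a chart \<Rightarrow> bool"
  where "is_chart X = (\<lambda>(U, \<phi>). openin X U \<and> open (\<phi> ` U) \<and>
    homeomorphic_map (subtopology X U) (top_of_set (\<phi> ` U)) \<phi>)"

text \<open>\<open>Im (cnj (D 1) * D \<i>)\<close> is the determinant of the real linear map \<open>D\<close> on the plane.\<close>

definition oriented_smooth_atlas :: "'a topology \<Rightarrow> 'a chart set \<Rightarrow> bool"
  where "oriented_smooth_atlas X A \<longleftrightarrow> (\<forall>c\<in>A. is_chart X c) \<and> \<Union> (fst ` A) = topspace X \<and>
    (\<forall>(U, \<phi>)\<in>A. \<forall>(V, \<psi>)\<in>A.
       smooth_map_on (\<phi> ` (U \<inter> V)) (\<psi> \<circ> inv_into U \<phi>) \<and>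
       (\<forall>z\<in>\<phi> ` (U \<inter> V). let D = frechet_derivative (\<psi> \<circ> inv_into U \<phi>) (at z)
                          in Im (cnj (D 1) * D \<i>) > 0))"

text \<open>The genus is half the first Betti number.\<close>

definition closed_oriented_surface :: "'a topology \<Rightarrow> 'a chart set \<Rightarrow> nat \<Rightarrow> bool"
  where "closed_oriented_surface X A g \<longleftrightarrow>
    Hausdorff_space X \<and> compact_space X \<and> connected_space X \<and> oriented_smooth_atlas X A \<and>
    homology_group 1 X \<cong> free_Abelian_group {..<2 * g}"

text \<open>
  The conformal structure on the surface \<open>(X, A)\<close> of the Riemannian metric pulled back from the
  quotient manifold by an immersion \<open>F\<close>: its charts are the oriented isothermal coordinates, i.e.
  the charts \<open>\<phi>\<close> of the oriented smooth surface for which the metric is \<open>\<rho> |dz|\<^sup>2\<close>. By the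
  existence of isothermal coordinates they form a complex atlas.
\<close>

definition induced_conformal_structure ::
    "'a topology \<Rightarrow> 'a chart set \<Rightarrow> (mat2 \<Rightarrow> mat2) set \<Rightarrow> ('a \<Rightarrow> mat2 set) \<Rightarrow> 'a chart set"
  where "induced_conformal_structure X A \<Gamma> F =
    {(U, \<phi>). oriented_smooth_atlas X (insert (U, \<phi>) A) \<and>
       conformal_immersion_to_quotient \<Gamma> (\<phi> ` U) (F \<circ> inv_into U \<phi>)}"

text \<open>
  The identification of \<open>S\<close> with the surface \<open>(X, A)\<close>: a diffeomorphism \<open>h\<close> in the homotopy class
  determined by the homeomorphism \<open>\<Psi>\<close> from \<open>X \<times> \<real>\<close> to the quotient manifold.
\<close>

definition marking ::
    "'a topology \<Rightarrow> 'a chart set \<Rightarrow> (mat2 \<Rightarrow> mat2) set \<Rightarrow> ('a \<times> real \<Rightarrow> mat2 set) \<Rightarrow>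
     mat2 set set \<Rightarrow> ('a \<Rightarrow> mat2 set) \<Rightarrow> bool"
  where "marking X A \<Gamma> \<Psi> S h \<longleftrightarrow>
    homeomorphic_map X (subtopology (hyp_quotient \<Gamma>) S) h \<and>
    (\<forall>(U, \<phi>)\<in>A. immersion_to_quotient \<Gamma> (\<phi> ` U) (h \<circ> inv_into U \<phi>)) \<and>
    homotopic_with (\<lambda>_. True) X (hyp_quotient \<Gamma>) h (\<lambda>x. \<Psi> (x, 0))"


section \<open>Quasiconformal maps and the Teichmueller distance\<close>

definition abs_continuous_on :: "real \<Rightarrow> real \<Rightarrow> (real \<Rightarrow> complex) \<Rightarrow> bool"
  where "abs_continuous_on a b f \<longleftrightarrow>
    (\<forall>\<epsilon>>0. \<exists>\<delta>>0. \<forall>D. finite D \<longrightarrow> (\<forall>(s, t)\<in>D. a \<le> s \<and> s \<le> t \<and> t \<le> b) \<longrightarrow>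
       pairwise (\<lambda>(s, t) (s', t'). {s<..<t} \<inter> {s'<..<t'} = {}) D \<longrightarrow>
       (\<Sum>(s, t)\<in>D. t - s) < \<delta> \<longrightarrow> (\<Sum>(s, t)\<in>D. cmod (f t - f s)) < \<epsilon>)"

definition ACL_on :: "complex set \<Rightarrow> (complex \<Rightarrow> complex) \<Rightarrow> bool"
  where "ACL_on W f \<longleftrightarrow> (\<forall>a b. cbox a b \<subseteq> W \<longrightarrow>
    (AE y in lebesgue. y \<in> {Im a..Im b} \<longrightarrow> abs_continuous_on (Re a) (Re b) (\<lambda>x. f (Complex x y))) \<and>
    (AE x in lebesgue. x \<in> {Re a..Re b} \<longrightarrow> abs_continuous_on (Im a) (Im b) (\<lambda>y. f (Complex x y))))"

text \<open>
  The analytic definition: \<open>f\<close> is a homeomorphism onto its image, absolutely continuous on lines,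
  and \<open>|f\<^sub>z\<^sub>b\<^sub>a\<^sub>r| \<le> (K - 1) / (K + 1) |f\<^sub>z|\<close> almost everywhere, where \<open>f\<^sub>z = (f\<^sub>x - i f\<^sub>y) / 2\<close> and
  \<open>f\<^sub>z\<^sub>b\<^sub>a\<^sub>r = (f\<^sub>x + i f\<^sub>y) / 2\<close>. For such \<open>f\<close> this implies that \<open>f\<close> preserves the orientation.
\<close>

definition quasiconformal_on :: "real \<Rightarrow> complex set \<Rightarrow> (complex \<Rightarrow> complex) \<Rightarrow> bool"
  where "quasiconformal_on K W f \<longleftrightarrow>
    (\<exists>g. homeomorphism W (f ` W) f g) \<and> ACL_on W f \<and>
    (AE z in lebesgue. z \<in> W \<longrightarrow>
       (\<exists>fx fy. ((\<lambda>t. f (z + of_real t)) has_vector_derivative fx) (at 0) \<and>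
                ((\<lambda>t. f (z + \<i> * of_real t)) has_vector_derivative fy) (at 0) \<and>
                cmod ((fx + \<i> * fy) / 2) \<le> (K - 1) / (K + 1) * cmod ((fx - \<i> * fy) / 2)))"

definition quasiconformal_map ::
    "'a topology \<Rightarrow> 'a chart set \<Rightarrow> 'a chart set \<Rightarrow> real \<Rightarrow> ('a \<Rightarrow> 'a) \<Rightarrow> bool"
  where "quasiconformal_map X \<sigma>1 \<sigma>2 K f \<longleftrightarrow> K \<ge> 1 \<and> homeomorphic_map X X f \<and>
    (\<forall>(U, \<phi>)\<in>\<sigma>1. \<forall>(V, \<psi>)\<in>\<sigma>2.
       quasiconformal_on K (\<phi> ` {x \<in> U. f x \<in> V}) (\<psi> \<circ> f \<circ> inv_into U \<phi>))"

definition maximal_dilatation ::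
    "'a topology \<Rightarrow> 'a chart set \<Rightarrow> 'a chart set \<Rightarrow> ('a \<Rightarrow> 'a) \<Rightarrow> real"
  where "maximal_dilatation X \<sigma>1 \<sigma>2 f = Inf {K. quasiconformal_map X \<sigma>1 \<sigma>2 K f}"

definition teichmueller_dist :: "'a topology \<Rightarrow> 'a chart set \<Rightarrow> 'a chart set \<Rightarrow> real"
  where "teichmueller_dist X \<sigma>1 \<sigma>2 = 1 / 2 * ln (Inf {maximal_dilatation X \<sigma>1 \<sigma>2 f | f.
     (\<exists>K. quasiconformal_map X \<sigma>1 \<sigma>2 K f) \<and> homotopic_with (\<lambda>_. True) X X f id})"


section \<open>Consistency checks\<close>

lemma istopology_hyp_quotient:
  "istopology (\<lambda>U. U \<subseteq> orbit_of \<Gamma> ` H3 \<and> openin (top_of_set H3) {x \<in> H3. orbit_of \<Gamma> x \<in> U})"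
proof -
  have 1: "{x \<in> H3. orbit_of \<Gamma> x \<in> S \<inter> T}
      = {x \<in> H3. orbit_of \<Gamma> x \<in> S} \<inter> {x \<in> H3. orbit_of \<Gamma> x \<in> T}" for S T by blast
  have 2: "{x \<in> H3. orbit_of \<Gamma> x \<in> \<Union> \<K>} = \<Union> ((\<lambda>U. {x \<in> H3. orbit_of \<Gamma> x \<in> U}) ` \<K>)" for \<K>
    by blast
  show ?thesis
    unfolding istopology_def 1 2 by (auto intro!: openin_Inter openin_Union)
qed

lemma openin_hyp_quotient:
  "openin (hyp_quotient \<Gamma>) U \<longleftrightarrow>
    U \<subseteq> orbit_of \<Gamma> ` H3 \<and> openin (top_of_set H3) {x \<in> H3. orbit_of \<Gamma> x \<in> U}"
  by (simp add: hyp_quotient_def topology_inverse'[OF istopology_hyp_quotient])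

lemma topspace_hyp_quotient: "topspace (hyp_quotient \<Gamma>) = orbit_of \<Gamma> ` H3"
proof -
  have "openin (hyp_quotient \<Gamma>) (orbit_of \<Gamma> ` H3)"
  proof -
    have "{x \<in> H3. orbit_of \<Gamma> x \<in> orbit_of \<Gamma> ` H3} = H3" by blast
    then show ?thesis by (simp add: openin_hyp_quotient)
  qed
  then show ?thesis by (auto simp: topspace_def openin_hyp_quotient)
qed

lemma adj_mult: "adj (A ** B) = adj B ** adj A"
  by (simp add: adj_def matrix_matrix_mult_def vec_eq_iff mult.commute)

lemma moebius_comp: "moebius A \<circ> moebius B = moebius (A ** B)"
  by (simp add: fun_eq_iff moebius_def adj_mult matrix_mul_assoc)

lemma moebius_one: "moebius (mat 1) = id"
proof -
  have "adj (mat 1) = mat 1" by (simp add: adj_def mat_def vec_eq_iff)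
  then show ?thesis by (simp add: fun_eq_iff moebius_def)
qed

lemma group_PSL2C: "group PSL2C"
proof (rule groupI)
  fix x y assume "x \<in> carrier PSL2C" "y \<in> carrier PSL2C"
  then show "x \<otimes>\<^bsub>PSL2C\<^esub> y \<in> carrier PSL2C"
    by (auto simp: PSL2C_def SL2C_def moebius_comp det_mul)
next
  show "\<one>\<^bsub>PSL2C\<^esub> \<in> carrier PSL2C"
    by (auto simp: PSL2C_def SL2C_def moebius_one[symmetric])
next
  fix x assume "x \<in> carrier PSL2C"
  then obtain A where A: "x = moebius A" "det A = 1" by (auto simp: PSL2C_def SL2C_def)
  then have "invertible A" by (simp add: invertible_det_nz)
  then obtain B where B: "B ** A = mat 1" by (auto simp: invertible_def)
  have "det B = 1" using arg_cong[OF B, of det] A by (simp add: det_mul)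
  then show "\<exists>y\<in>carrier PSL2C. y \<otimes>\<^bsub>PSL2C\<^esub> x = \<one>\<^bsub>PSL2C\<^esub>"
    using A B by (auto simp: PSL2C_def SL2C_def moebius_comp moebius_one intro!: bexI[of _ B])
qed (auto simp: PSL2C_def comp_assoc)

lemma mink_eq:
  "mink X Y = Re (X$1$2 * Y$2$1 + X$2$1 * Y$1$2 - X$1$1 * Y$2$2 - X$2$2 * Y$1$1) / 2"
  unfolding mink_def trace_def matrix_matrix_mult_def
  by (simp add: sum_2 algebra_simps)

lemma mink_self: "mink X X = - Re (det X)"
  by (simp add: mink_eq det_2)

lemma bounded_bilinear_mink: "bounded_bilinear mink"
  unfolding bilinear_conv_bounded_bilinear[symmetric] bilinear_def
  by (auto intro!: linearI simp: mink_eq field_simps)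

lemma mink_commute: "mink X Y = mink Y X"
  by (simp add: mink_eq algebra_simps)

lemma hermitian_iff: "hermitian X \<longleftrightarrow> Im (X$1$1) = 0 \<and> Im (X$2$2) = 0 \<and> X$2$1 = cnj (X$1$2)"
  by (auto simp: hermitian_def adj_def vec_eq_iff forall_2 complex_eq_iff)

lemma H3_iff: "X \<in> H3 \<longleftrightarrow> hermitian X \<and> mink X X = -1 \<and> Re (X$1$1) > 0"
proof (cases "hermitian X")
  case True
  define a d m where "a = Re (X$1$1)" and "d = Re (X$2$2)" and "m = (cmod (X$1$2))\<^sup>2"
  have X: "X$1$1 = of_real a" "X$2$2 = of_real d" "X$2$1 = cnj (X$1$2)"
    using True by (auto simp: hermitian_iff a_def d_def complex_eq_iff)
  have D: "det X = of_real (a * d - m)"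
    by (simp add: det_2 X m_def complex_norm_square[symmetric])
  have T: "Re (trace X) = a + d" by (simp add: trace_def sum_2 a_def d_def)
  have m: "m \<ge> 0" by (simp add: m_def)
  have pos: "a + d > 0 \<longleftrightarrow> a > 0" if "a * d - m = 1"
  proof -
    have "a * d > 0" using that m by linarith
    then show ?thesis by (auto simp: zero_less_mult_iff)
  qed
  have "mink X X = - (a * d - m)" by (simp add: mink_self D)
  moreover have "det X = 1 \<longleftrightarrow> a * d - m = 1" unfolding D by (simp only: of_real_eq_1_iff)
  ultimately show ?thesis using True T pos by (auto simp: H3_def a_def[symmetric])
qed (simp add: H3_def)

lemma mink_H3: "p \<in> H3 \<Longrightarrow> mink p p = -1"
  by (simp add: H3_iff)

lemma geodesic_exists:
  assumes p: "p \<in> H3" and v: "v \<in> H3_tangent p" "mink v v = 1"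
  shows "geodesic (\<lambda>t. cosh (r * t) *\<^sub>R p + sinh (r * t) *\<^sub>R v)
           (\<lambda>t. r *\<^sub>R (sinh (r * t) *\<^sub>R p + cosh (r * t) *\<^sub>R v))"
    (is "geodesic ?c ?d")
proof -
  interpret M: bounded_bilinear mink by (rule bounded_bilinear_mink)
  have pp: "mink p p = -1" "mink p v = 0" "mink v p = 0" "mink v v = 1"
    using p v by (auto simp: H3_iff H3_tangent_def mink_commute[of v p])
  have cc: "mink (?c t) (?c t) = -1" for t
    using cosh_square_eq[of "r * t"]
    by (simp add: M.add_left M.add_right M.scaleR_left M.scaleR_right pp power2_eq_square)
  have dd: "mink (?d t) (?d t) = r * r" for t
    using cosh_square_eq[of "r * t"]
    by (simp add: M.add_left M.add_right M.scaleR_left M.scaleR_right pp power2_eq_square algebra_simps)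
  have herm: "hermitian (?c t)" for t
    using p v by (auto simp: H3_iff H3_tangent_def hermitian_iff)
  have pos: "Re (?c t $ 1 $ 1) > 0" for t
  proof (rule ccontr)
    assume neg: "\<not> ?thesis"
    have cont: "continuous_on UNIV (\<lambda>t. Re (?c t $ 1 $ 1))"
      by (simp, intro continuous_intros)
    have "0 \<in> (\<lambda>t. Re (?c t $ 1 $ 1)) ` UNIV"
    proof -
      have conn: "connected ((\<lambda>t. Re (?c t $ 1 $ 1)) ` UNIV)"
        using connected_continuous_image[OF cont] by blast
      have "Re (?c 0 $ 1 $ 1) > 0" using p by (simp add: H3_iff)
      then show ?thesis using neg connectedD_interval[OF conn, of "Re (?c t $ 1 $ 1)" "Re (?c 0 $ 1 $ 1)" 0]
        by (metis (no_types, lifting) linorder_not_less order_less_imp_le rangeI)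
    qed
    then obtain s where s: "Re (?c s $ 1 $ 1) = 0" by auto
    define Z where "Z = ?c s"
    have h: "hermitian Z" "mink Z Z = -1" "Re (Z $ 1 $ 1) = 0"
      using herm[of s] cc[of s] s by (simp_all only: Z_def)
    then have "Z $ 1 $ 1 = 0" "Z $ 2 $ 1 = cnj (Z $ 1 $ 2)"
      by (auto simp: hermitian_iff complex_eq_iff)
    then have "mink Z Z = (cmod (Z $ 1 $ 2))\<^sup>2"
      unfolding cmod_power2 by (simp add: mink_eq power2_eq_square)
    with h(2) show False by (smt (verit) zero_le_power2)
  qed
  have "(?c has_vector_derivative ?d t) (at t)" for t
    by (auto intro!: derivative_eq_intros simp: has_real_derivative_iff_has_vector_derivative[symmetric] scaleR_add_right mult_ac)
  moreover have "(?d has_vector_derivative mink (?d t) (?d t) *\<^sub>R ?c t) (at t)" for t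
    unfolding dd
    by (auto intro!: derivative_eq_intros simp: has_real_derivative_iff_has_vector_derivative[symmetric] scaleR_add_right mult_ac)
  ultimately show ?thesis
    unfolding geodesic_def using herm cc pos by (auto simp only: H3_iff)
qed

lemma exp_growth_unique:
  fixes u :: "real \<Rightarrow> 'a::real_normed_vector"
  assumes "\<And>t. (u has_vector_derivative k *\<^sub>R u t) (at t)"
  shows "u 1 = exp k *\<^sub>R u 0"
proof -
  have "((\<lambda>t. exp (- k * t) *\<^sub>R u t) has_vector_derivative 0) (at t)" for t
  proof -
    have "((\<lambda>t. exp (- k * t)) has_field_derivative - k * exp (- k * t)) (at t)"
      by (auto intro!: derivative_eq_intros)
    from has_vector_derivative_scaleR[OF this assms] show ?thesis by (simp add: mult.commute)
  qed
  then obtain C where "\<And>t. exp (- k * t) *\<^sub>R u t = C"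
    using has_vector_derivative_zero_constant[of UNIV "\<lambda>t. exp (- k * t) *\<^sub>R u t"] by auto
  from this[of 0] this[of 1] have "exp (- k) *\<^sub>R u 1 = u 0" by simp
  then have "exp k *\<^sub>R (exp (- k) *\<^sub>R u 1) = exp k *\<^sub>R u 0" by simp
  then show ?thesis by (simp add: exp_minus)
qed

lemma geodesic_speed:
  assumes "geodesic c c'"
  shows "mink (c' t) (c' t) = mink (c' 0) (c' 0)"
proof -
  interpret M: bounded_bilinear mink by (rule bounded_bilinear_mink)
  have d: "(c has_vector_derivative c' t) (at t)"
       "(c' has_vector_derivative mink (c' t) (c' t) *\<^sub>R c t) (at t)"
       "mink (c t) (c t) = -1" for t
    using assms by (auto simp: geodesic_def H3_iff)
  have orth: "mink (c t) (c' t) = 0" for t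
  proof -
    have "((\<lambda>t. mink (c t) (c t)) has_vector_derivative mink (c t) (c' t) + mink (c' t) (c t)) (at t)"
      by (rule M.has_vector_derivative[OF d(1) d(1)])
    moreover have "((\<lambda>t. mink (c t) (c t)) has_vector_derivative 0) (at t)"
      by (simp add: d(3))
    ultimately show ?thesis
      using vector_derivative_unique_at mink_commute by fastforce
  qed
  have "((\<lambda>t. mink (c' t) (c' t)) has_vector_derivative 0) (at t)" for t
    using M.has_vector_derivative[OF d(2) d(2), of t]
    by (simp add: M.scaleR_left M.scaleR_right orth mink_commute[of "c' t" "c t"])
  then obtain C where "\<And>t. mink (c' t) (c' t) = C"
    using has_vector_derivative_zero_constant[of UNIV "\<lambda>t. mink (c' t) (c' t)"] by auto
  then show ?thesis by simp
qed

lemma hexp_unit: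
  assumes p: "p \<in> H3" and v: "v \<in> H3_tangent p" "mink v v = 1"
  shows "hexp p (r *\<^sub>R v) = cosh r *\<^sub>R p + sinh r *\<^sub>R v"
  unfolding hexp_def
proof (rule the_equality)
  show "\<exists>c c'. geodesic c c' \<and> c 0 = p \<and> c' 0 = r *\<^sub>R v \<and> c 1 = cosh r *\<^sub>R p + sinh r *\<^sub>R v"
    by (intro exI conjI, rule geodesic_exists[OF assms, of r]) simp_all
next
  interpret M: bounded_bilinear mink by (rule bounded_bilinear_mink)
  fix q assume "\<exists>c c'. geodesic c c' \<and> c 0 = p \<and> c' 0 = r *\<^sub>R v \<and> c 1 = q"
  then obtain c c' where g: "geodesic c c'" and i: "c 0 = p" "c' 0 = r *\<^sub>R v" "c 1 = q" by blast
  have E: "mink (c' t) (c' t) = r * r" for t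
    using geodesic_speed[OF g, of t] v(2) by (simp add: i M.scaleR_left M.scaleR_right)
  have d: "(c has_vector_derivative c' t) (at t)"
       "(c' has_vector_derivative (r * r) *\<^sub>R c t) (at t)" for t
    using g by (auto simp: geodesic_def E)
  have "((\<lambda>t. c' t - r *\<^sub>R c t) has_vector_derivative (- r) *\<^sub>R (c' t - r *\<^sub>R c t)) (at t)" for t
    by (auto intro!: derivative_eq_intros d simp: algebra_simps)
  from exp_growth_unique[OF this] have u: "c' 1 - r *\<^sub>R q = exp (- r) *\<^sub>R (r *\<^sub>R v - r *\<^sub>R p)"
    by (simp add: i)
  have "((\<lambda>t. c' t + r *\<^sub>R c t) has_vector_derivative r *\<^sub>R (c' t + r *\<^sub>R c t)) (at t)" for t
    by (auto intro!: derivative_eq_intros d simp: algebra_simps)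
  from exp_growth_unique[OF this] have w: "c' 1 + r *\<^sub>R q = exp r *\<^sub>R (r *\<^sub>R v + r *\<^sub>R p)"
    by (simp add: i)
  show "q = cosh r *\<^sub>R p + sinh r *\<^sub>R v"
  proof (cases "r = 0")
    case True
    then have "c' 1 = 0" and "\<And>t. (c' has_vector_derivative 0) (at t)"
      using w d(2) by auto
    then obtain C where "\<And>t. c' t = C"
      using has_vector_derivative_zero_constant[of UNIV c'] by auto
    with \<open>c' 1 = 0\<close> have "c' t = 0" for t by metis
    then have "\<And>t. (c has_vector_derivative 0) (at t)" using d(1) by metis
    then obtain C where "\<And>t. c t = C"
      using has_vector_derivative_zero_constant[of UNIV c] by auto
    then show ?thesis using i True by simp
  next
    case False
    have "(2 * r) *\<^sub>R q = (c' 1 + r *\<^sub>R q) - (c' 1 - r *\<^sub>R q)"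
      by (simp add: algebra_simps flip: scaleR_2)
    also have "\<dots> = (2 * r) *\<^sub>R (cosh r *\<^sub>R p + sinh r *\<^sub>R v)"
      unfolding u w cosh_def sinh_def by (simp add: algebra_simps)
    finally show ?thesis using False by simp
  qed
qed

end

theory Submission
  imports Defs
begin

text \<open>
  Both estimates follow by taking the identity of the surface as the competing quasiconformal map.
  Its dilatation is computed pointwise. Along the minimal surface \<open>S\<close>, choose an orthonormal basis of
  principal directions, with principal curvatures \<open>\<mu>\<close> and \<open>-\<mu>\<close>. Moving the distance \<open>r\<close> along the
  normal geodesics takes the point \<open>p\<close> of the hyperboloid to \<open>cosh r p + sinh r \<nu> p\<close>, and the
  differential of this map multiplies the two principal directions by \<open>cosh r (1 - \<mu> tanh r)\<close> and
  \<open>cosh r (1 + \<mu> tanh r)\<close> (\<open>parallel_metric\<close>). So the metrics of \<open>S(r1)\<close> and \<open>S(r2)\<close> are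
  diagonal in the same basis, and the dilatation of the identity at the point is the quotient of the
  values of \<open>(1 + \<mu> tanh r) / (1 - \<mu> tanh r)\<close> at \<open>r2\<close> and \<open>r1\<close>, or the inverse of this quotient
  (\<open>diagonal_forms_ratio\<close>). It increases with \<open>\<mu>\<close> (\<open>dilatation_exponent_mono\<close>), so it is bounded by
  its value at \<open>\<mu> = \<lambda>\<^sub>0\<close>.

  This computation has to be transported to the charts of the two conformal structures. These are
  isothermal coordinates, smoothly compatible with a fixed atlas of the surface, so the transition
  maps are continuously differentiable (\<open>C1_transition\<close>); they are therefore absolutely continuous on
  lines, and quasiconformality reduces to the distortion of their differentials
  (\<open>C1_on_imp_quasiconformal_on\<close>). An isothermal chart comes with a conformal lift to hyperbolic space,
  which agrees with the parallel lift of \<open>S\<close> only up to elements of \<open>\<Gamma>\<close> that might vary from point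
  to point. As \<open>\<Gamma>\<close> is countable, a Baire category argument shows that the two lifts induce the same
  metric (\<open>lifts_isometric\<close>), and so the differential of a transition map distorts exactly as the
  two diagonal metrics prescribe (\<open>transition_stretch\<close>).
\<close>

section \<open>Continuously differentiable maps\<close>

lemma Ck_on_subset: "Ck_on k f U \<Longrightarrow> V \<subseteq> U \<Longrightarrow> Ck_on k f V"
  by (induction k arbitrary: f) (auto intro: continuous_on_subset)

lemma smooth_map_on_imp_C1: "smooth_map_on U f \<Longrightarrow> Ck_on (Suc 0) f U"
  by (simp only: smooth_map_on_def)

lemma C1_on_differentiable: "Ck_on (Suc 0) f U \<Longrightarrow> x \<in> U \<Longrightarrow> f differentiable (at x)"
  by simp

lemma C1_on_has_derivative:
  "Ck_on (Suc 0) f U \<Longrightarrow> x \<in> U \<Longrightarrow> (f has_derivative frechet_derivative f (at x)) (at x)"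
  by (simp add: frechet_derivative_works[symmetric])

lemma C1_on_continuous: "Ck_on (Suc 0) f U \<Longrightarrow> continuous_on U f"
  by (meson C1_on_differentiable continuous_at_imp_continuous_on differentiable_imp_continuous_within)

lemma C1_on_cong:
  assumes "Ck_on (Suc 0) f U" "open U" "\<And>x. x \<in> U \<Longrightarrow> f x = g x"
  shows "Ck_on (Suc 0) g U"
    and "x \<in> U \<Longrightarrow> frechet_derivative g (at x) = frechet_derivative f (at x)"
proof -
  have D: "frechet_derivative f (at x) = frechet_derivative g (at x)" if "x \<in> U" for x
    using frechet_derivative_transform_within_open[OF _ assms(2) that assms(3)]
      C1_on_differentiable[OF assms(1) that] by simp
  have "g differentiable at x" if "x \<in> U" for x
    using has_derivative_transform_within_open[OF C1_on_has_derivative[OF assms(1) that] assms(2) that assms(3)]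
    by (auto simp: differentiable_def)
  moreover have "continuous_on U (\<lambda>x. frechet_derivative g (at x) v)" for v
    using assms(1) by (simp add: D cong: continuous_on_cong)
  ultimately show "Ck_on (Suc 0) g U" by simp
  show "x \<in> U \<Longrightarrow> frechet_derivative g (at x) = frechet_derivative f (at x)" by (simp add: D)
qed

lemma C1_on_locally:
  assumes "\<And>x. x \<in> U \<Longrightarrow> \<exists>V. open V \<and> x \<in> V \<and> Ck_on (Suc 0) f V"
  shows "Ck_on (Suc 0) f U"
proof -
  have "f differentiable at x" if "x \<in> U" for x
    using assms[OF that] C1_on_differentiable by blast
  moreover have "continuous_on U (\<lambda>x. frechet_derivative f (at x) v)" for v
  proof (intro continuous_at_imp_continuous_on ballI)
    fix x assume "x \<in> U"
    then obtain V where "open V" "x \<in> V" "Ck_on (Suc 0) f V" using assms by blast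
    then have "open V" "x \<in> V" "continuous_on V (\<lambda>x. frechet_derivative f (at x) v)" by auto
    then show "isCont (\<lambda>x. frechet_derivative f (at x) v) x"
      by (simp add: continuous_on_eq_continuous_at)
  qed
  ultimately show ?thesis by simp
qed

text \<open>The differential is linear in the direction, so continuity of the directional derivatives, one
  direction at a time, gives continuity jointly in the base point and the direction.\<close>

lemma C1_on_continuous_derivative:
  fixes f :: "'a::euclidean_space \<Rightarrow> 'b::real_normed_vector"
  assumes f: "Ck_on (Suc 0) f W" and g: "continuous_on U g" "g ` U \<subseteq> W" and v: "continuous_on U v"
  shows "continuous_on U (\<lambda>x. frechet_derivative f (at (g x)) (v x))"
proof -
  have "frechet_derivative f (at (g x)) (v x)
      = (\<Sum>b\<in>Basis. (v x \<bullet> b) *\<^sub>R frechet_derivative f (at (g x)) b)" if "x \<in> U" for x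
  proof -
    have lin: "linear (frechet_derivative f (at (g x)))"
      using f g that by (intro linear_frechet_derivative) auto
    have "frechet_derivative f (at (g x)) (v x)
        = frechet_derivative f (at (g x)) (\<Sum>b\<in>Basis. (v x \<bullet> b) *\<^sub>R b)"
      by (simp add: euclidean_representation)
    also have "\<dots> = (\<Sum>b\<in>Basis. (v x \<bullet> b) *\<^sub>R frechet_derivative f (at (g x)) b)"
      by (simp add: linear_sum[OF lin] linear_scale[OF lin])
    finally show ?thesis .
  qed
  moreover have "continuous_on U (\<lambda>x. frechet_derivative f (at (g x)) b)" for b
    using f g continuous_on_compose2[of W "\<lambda>y. frechet_derivative f (at y) b" U g] by auto
  ultimately show ?thesis
    by (auto intro!: continuous_intros v cong: continuous_on_cong)
qed

lemma frechet_derivative_comp_apply: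
  "f differentiable at (g x) \<Longrightarrow> g differentiable at x \<Longrightarrow>
   frechet_derivative (f \<circ> g) (at x) v = frechet_derivative f (at (g x)) (frechet_derivative g (at x) v)"
  using frechet_derivative_compose[of g x f] by simp

lemma C1_on_compose:
  fixes f :: "'b::euclidean_space \<Rightarrow> 'c::real_normed_vector" and g :: "'a::euclidean_space \<Rightarrow> 'b"
  assumes g: "Ck_on (Suc 0) g U" and f: "Ck_on (Suc 0) f W" and im: "g ` U \<subseteq> W"
  shows "Ck_on (Suc 0) (f \<circ> g) U"
proof -
  have d: "f differentiable at (g x)" "g differentiable at x" if "x \<in> U" for x
    using assms that by auto
  have "continuous_on U (\<lambda>x. frechet_derivative f (at (g x)) (frechet_derivative g (at x) v))" for v
    using C1_on_continuous_derivative[OF f C1_on_continuous[OF g] im] g by simp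
  then have "continuous_on U (\<lambda>x. frechet_derivative (f \<circ> g) (at x) v)" for v
    by (simp add: frechet_derivative_comp_apply d cong: continuous_on_cong)
  moreover have "(f \<circ> g) differentiable at x" if "x \<in> U" for x
    using d[OF that] by (simp add: differentiable_chain_at)
  ultimately show ?thesis by simp
qed

text \<open>The mean value inequality on \<open>[0, h]\<close> for
  \<open>w s = f (z + s u + h v) - f (z + s u) - s h L v\<close>: differentiability of \<open>f' u\<close> at the single
  point \<open>z\<close> makes \<open>w'\<close> of order \<open>o(h)\<close>, so the second difference of \<open>f\<close> is \<open>h\<^sup>2 L v\<close> up to \<open>o(h\<^sup>2)\<close>.\<close>

lemma second_difference_bound:
  fixes f :: "'a::real_normed_vector \<Rightarrow> 'b::real_normed_vector"
  assumes op: "open U" "z \<in> U" and f: "\<And>x. x \<in> U \<Longrightarrow> (f has_derivative f' x) (at x)"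
    and L: "((\<lambda>x. f' x u) has_derivative L) (at z)" and "\<epsilon> > 0"
  shows "\<exists>\<delta>>0. \<forall>h. 0 < h \<and> h < \<delta> \<longrightarrow>
    norm (f (z + h *\<^sub>R u + h *\<^sub>R v) - f (z + h *\<^sub>R u) - f (z + h *\<^sub>R v) + f z - (h * h) *\<^sub>R L v) \<le> \<epsilon> * (h * h)"
proof -
  define C where "C = 2 * norm u + 2 * norm v + 1"
  have C: "C > 0" by (simp add: C_def add_nonneg_pos)
  define e where "e = \<epsilon> / C"
  have e: "e > 0" using C \<open>\<epsilon> > 0\<close> by (simp add: e_def)
  obtain d1 where d1: "d1 > 0" "\<And>y. norm (y - z) < d1 \<Longrightarrow> norm (f' y u - f' z u - L (y - z)) \<le> e * norm (y - z)"
    using L e unfolding has_derivative_at_alt by blast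
  obtain d2 where d2: "d2 > 0" "ball z d2 \<subseteq> U" using op openE by blast
  define \<delta> where "\<delta> = min d1 d2 / C"
  have lin: "linear L" using L has_derivative_linear by blast
  show ?thesis
  proof (intro exI conjI allI impI)
    show "\<delta> > 0" using d1 d2 C by (simp add: \<delta>_def)
    fix h :: real assume h: "0 < h \<and> h < \<delta>"
    have near: "norm (s *\<^sub>R u + t *\<^sub>R v) \<le> h * (norm u + norm v)" if "0 \<le> s" "s \<le> h" "0 \<le> t" "t \<le> h" for s t
    proof -
      have "norm (s *\<^sub>R u + t *\<^sub>R v) \<le> s * norm u + t * norm v"
        using norm_triangle_ineq[of "s *\<^sub>R u" "t *\<^sub>R v"] that by simp
      also have "\<dots> \<le> h * norm u + h * norm v" using that by (intro add_mono mult_right_mono) auto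
      finally show ?thesis by (simp add: algebra_simps)
    qed
    have "h * (norm u + norm v) \<le> h * C" using h by (intro mult_left_mono) (auto simp: C_def)
    also have "\<dots> < min d1 d2" using h C by (simp add: \<delta>_def pos_less_divide_eq)
    finally have small: "h * (norm u + norm v) < min d1 d2" .
    define w where "w s = f (z + s *\<^sub>R u + h *\<^sub>R v) - f (z + s *\<^sub>R u) - (s * h) *\<^sub>R L v" for s
    define w' where "w' s = f' (z + s *\<^sub>R u + h *\<^sub>R v) u - f' (z + s *\<^sub>R u) u - h *\<^sub>R L v" for s
    have U: "z + s *\<^sub>R u + t *\<^sub>R v \<in> U" if "0 \<le> s" "s \<le> h" "0 \<le> t" "t \<le> h" for s t
    proof -
      have "dist z (z + (s *\<^sub>R u + t *\<^sub>R v)) = norm (s *\<^sub>R u + t *\<^sub>R v)"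
        by (metis add_diff_cancel_left' dist_norm norm_minus_commute)
      then have "dist z (z + s *\<^sub>R u + t *\<^sub>R v) < d2"
        using near[OF that] small by (simp add: add.assoc)
      then show ?thesis using d2(2) by (auto simp: mem_ball)
    qed
    have der: "(w has_vector_derivative w' s) (at s)" if s: "s \<in> {0..h}" for s
    proof -
      have *: "((\<lambda>s. f (z + s *\<^sub>R u + t *\<^sub>R v)) has_vector_derivative f' (z + s *\<^sub>R u + t *\<^sub>R v) u) (at s)"
        if "0 \<le> t" "t \<le> h" for t
      proof -
        have "((\<lambda>s. z + s *\<^sub>R u + t *\<^sub>R v) has_derivative (\<lambda>r. r *\<^sub>R u)) (at s)"
          by (auto intro!: derivative_eq_intros)
        from diff_chain_at[OF this f[OF U]] s that
        have "((\<lambda>s. f (z + s *\<^sub>R u + t *\<^sub>R v)) has_derivative (\<lambda>r. f' (z + s *\<^sub>R u + t *\<^sub>R v) (r *\<^sub>R u))) (at s)"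
          by (auto simp: o_def)
        moreover have "linear (f' (z + s *\<^sub>R u + t *\<^sub>R v))"
          using has_derivative_linear[OF f[OF U[of s t]]] s that by auto
        ultimately show ?thesis by (simp add: has_vector_derivative_def linear_scale)
      qed
      have "((\<lambda>s. (s * h) *\<^sub>R L v) has_vector_derivative h *\<^sub>R L v) (at s)"
        by (auto intro!: derivative_eq_intros simp: has_vector_derivative_def mult.commute)
      from has_vector_derivative_diff[OF has_vector_derivative_diff[OF *[of h] *[of 0]] this] h
      show ?thesis by (simp add: w_def[abs_def] w'_def)
    qed
    have bd: "norm (w' s) \<le> \<epsilon> * h" if s: "s \<in> {0..h}" for s
    proof -
      let ?a = "f' (z + s *\<^sub>R u + h *\<^sub>R v) u - f' z u - L (s *\<^sub>R u + h *\<^sub>R v)"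
      let ?b = "f' (z + s *\<^sub>R u) u - f' z u - L (s *\<^sub>R u)"
      have a: "norm ?a \<le> e * (h * (norm u + norm v))"
      proof -
        have n: "norm (s *\<^sub>R u + h *\<^sub>R v) \<le> h * (norm u + norm v)" using near s h by auto
        then have "norm ?a \<le> e * norm (s *\<^sub>R u + h *\<^sub>R v)"
          using d1(2)[of "z + s *\<^sub>R u + h *\<^sub>R v"] small by (simp add: add.assoc)
        also have "\<dots> \<le> e * (h * (norm u + norm v))" using n e by (intro mult_left_mono) auto
        finally show ?thesis .
      qed
      have b: "norm ?b \<le> e * (h * (norm u + norm v))"
      proof -
        have n: "norm (s *\<^sub>R u) \<le> h * (norm u + norm v)" using near[of s 0] s h by auto
        then have "norm ?b \<le> e * norm (s *\<^sub>R u)"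
          using d1(2)[of "z + s *\<^sub>R u"] small by (simp add: add.assoc del: norm_scaleR)
        also have "\<dots> \<le> e * (h * (norm u + norm v))" using n e by (intro mult_left_mono) auto
        finally show ?thesis .
      qed
      have "w' s = ?a - ?b"
        by (simp add: w'_def linear_add[OF lin] linear_scale[OF lin])
      then have "norm (w' s) \<le> e * (h * (norm u + norm v)) + e * (h * (norm u + norm v))"
        using norm_triangle_ineq4[of ?a ?b] a b by simp
      also have "\<dots> = e * h * (2 * norm u + 2 * norm v)" by (simp add: algebra_simps)
      also have "\<dots> \<le> e * h * C" using e h by (intro mult_left_mono) (auto simp: C_def)
      also have "\<dots> = \<epsilon> * h" using C by (simp add: e_def)
      finally show ?thesis .
    qed
    have "norm (w h - w 0) \<le> (\<epsilon> * h) * norm (h - 0)"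
    proof (rule differentiable_bound[of "{0..h}" w "\<lambda>s r. r *\<^sub>R w' s"])
      show "(w has_derivative (\<lambda>r. r *\<^sub>R w' s)) (at s within {0..h})" if "s \<in> {0..h}" for s
        using der[OF that] by (auto simp: has_vector_derivative_def intro: has_derivative_at_withinI)
      show "onorm (\<lambda>r. r *\<^sub>R w' s) \<le> \<epsilon> * h" if "s \<in> {0..h}" for s
        using bd[OF that] by (intro onorm_le) (simp add: mult.commute mult_left_mono)
    qed (use h in auto)
    then show "norm (f (z + h *\<^sub>R u + h *\<^sub>R v) - f (z + h *\<^sub>R u) - f (z + h *\<^sub>R v) + f z - (h * h) *\<^sub>R L v) \<le> \<epsilon> * (h * h)"
      using h by (simp add: w_def algebra_simps)
  qed
qed

text \<open>The second difference of \<open>f\<close> is symmetric in \<open>u\<close> and \<open>v\<close>, so its quotient by \<open>h\<^sup>2\<close> tends to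
  both sides of the equation.\<close>

lemma second_derivative_symmetric:
  fixes f :: "'a::real_normed_vector \<Rightarrow> 'b::real_normed_vector"
  assumes op: "open U" "z \<in> U" and f: "\<And>x. x \<in> U \<Longrightarrow> (f has_derivative f' x) (at x)"
    and L: "((\<lambda>x. f' x u) has_derivative L) (at z)" and M: "((\<lambda>x. f' x v) has_derivative M) (at z)"
  shows "L v = M u"
proof (rule ccontr)
  assume ne: "L v \<noteq> M u"
  define \<epsilon> where "\<epsilon> = norm (L v - M u) / 3"
  have e: "\<epsilon> > 0" using ne by (simp add: \<epsilon>_def)
  let ?\<Delta> = "\<lambda>h. f (z + h *\<^sub>R u + h *\<^sub>R v) - f (z + h *\<^sub>R u) - f (z + h *\<^sub>R v) + f z"
  obtain d1 where d1: "d1 > 0" "\<And>h. 0 < h \<Longrightarrow> h < d1 \<Longrightarrow> norm (?\<Delta> h - (h * h) *\<^sub>R L v) \<le> \<epsilon> * (h * h)"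
    using second_difference_bound[OF op f L e, of v] by blast
  obtain d2 where d2: "d2 > 0" "\<And>h. 0 < h \<Longrightarrow> h < d2 \<Longrightarrow>
      norm (f (z + h *\<^sub>R v + h *\<^sub>R u) - f (z + h *\<^sub>R v) - f (z + h *\<^sub>R u) + f z - (h * h) *\<^sub>R M u) \<le> \<epsilon> * (h * h)"
    using second_difference_bound[OF op f M e, of u] by blast
  define h where "h = min d1 d2 / 2"
  have h: "0 < h" "h < d1" "h < d2" using d1(1) d2(1) by (auto simp: h_def)
  have 1: "norm (?\<Delta> h - (h * h) *\<^sub>R L v) \<le> \<epsilon> * (h * h)" using d1 h by blast
  have "f (z + h *\<^sub>R v + h *\<^sub>R u) - f (z + h *\<^sub>R v) - f (z + h *\<^sub>R u) + f z = ?\<Delta> h"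
    by (simp add: algebra_simps)
  then have 2: "norm (?\<Delta> h - (h * h) *\<^sub>R M u) \<le> \<epsilon> * (h * h)" using d2(2) h by metis
  have "(h * h) * norm (L v - M u) = norm ((?\<Delta> h - (h * h) *\<^sub>R M u) - (?\<Delta> h - (h * h) *\<^sub>R L v))"
    using h by (simp add: scaleR_diff_right[symmetric] abs_mult)
  also have "\<dots> \<le> \<epsilon> * (h * h) + \<epsilon> * (h * h)"
    using norm_triangle_ineq4 1 2 by (smt (verit))
  finally have "(h * h) * norm (L v - M u) \<le> (h * h) * (2 * \<epsilon>)" by (simp add: algebra_simps)
  then have "norm (L v - M u) \<le> 2 * \<epsilon>" using h by simp
  then show False using e by (simp add: \<epsilon>_def)
qed

section \<open>Quasiconformality of smooth maps\<close>

lemma lipschitz_imp_abs_continuous_on: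
  assumes "\<And>s t. a \<le> s \<Longrightarrow> s \<le> t \<Longrightarrow> t \<le> b \<Longrightarrow> cmod (f t - f s) \<le> B * (t - s)"
  shows "abs_continuous_on a b f"
  unfolding abs_continuous_on_def
proof (intro allI impI)
  fix \<epsilon> :: real assume "\<epsilon> > 0"
  define C where "C = max B 0 + 1"
  have C: "C > 0" "B \<le> C" by (auto simp: C_def)
  show "\<exists>\<delta>>0. \<forall>D. finite D \<longrightarrow> (\<forall>(s, t)\<in>D. a \<le> s \<and> s \<le> t \<and> t \<le> b) \<longrightarrow>
       pairwise (\<lambda>(s, t) (s', t'). {s<..<t} \<inter> {s'<..<t'} = {}) D \<longrightarrow>
       (\<Sum>(s, t)\<in>D. t - s) < \<delta> \<longrightarrow> (\<Sum>(s, t)\<in>D. cmod (f t - f s)) < \<epsilon>"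
  proof (intro exI[of _ "\<epsilon> / C"] conjI allI impI)
    fix D :: "(real \<times> real) set"
    assume D: "\<forall>(s, t)\<in>D. a \<le> s \<and> s \<le> t \<and> t \<le> b" and small: "(\<Sum>(s, t)\<in>D. t - s) < \<epsilon> / C"
    have "(\<Sum>(s, t)\<in>D. cmod (f t - f s)) \<le> (\<Sum>(s, t)\<in>D. C * (t - s))"
    proof (rule sum_mono)
      fix p assume p: "p \<in> D"
      obtain s t where st: "p = (s, t)" by (cases p)
      then have "a \<le> s" "s \<le> t" "t \<le> b" using D p by auto
      then have "cmod (f t - f s) \<le> B * (t - s)" "B * (t - s) \<le> C * (t - s)"
        using assms C by (auto intro: mult_right_mono)
      then show "(case p of (s, t) \<Rightarrow> cmod (f t - f s)) \<le> (case p of (s, t) \<Rightarrow> C * (t - s))"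
        by (simp add: st)
    qed
    also have "\<dots> = C * (\<Sum>(s, t)\<in>D. t - s)" by (simp add: sum_distrib_left case_prod_unfold)
    also have "\<dots> < \<epsilon>" using small C by (simp add: pos_less_divide_eq mult.commute)
    finally show "(\<Sum>(s, t)\<in>D. cmod (f t - f s)) < \<epsilon>" .
  qed (use C \<open>\<epsilon> > 0\<close> in auto)
qed

lemma C1_on_lipschitz_on_line:
  fixes f :: "'a::euclidean_space \<Rightarrow> 'b::real_normed_vector"
  assumes f: "Ck_on (Suc 0) f W" and line: "\<And>s. s \<in> {a..b} \<Longrightarrow> p + s *\<^sub>R d \<in> W"
    and B: "\<And>s. s \<in> {a..b} \<Longrightarrow> norm (frechet_derivative f (at (p + s *\<^sub>R d)) d) \<le> B"
    and st: "a \<le> s" "s \<le> t" "t \<le> b"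
  shows "norm (f (p + t *\<^sub>R d) - f (p + s *\<^sub>R d)) \<le> B * (t - s)"
proof -
  let ?D = "\<lambda>s. frechet_derivative f (at (p + s *\<^sub>R d))"
  have "norm (f (p + t *\<^sub>R d) - f (p + s *\<^sub>R d)) \<le> B * norm (t - s)"
  proof (rule differentiable_bound[of "{a..b}" "\<lambda>s. f (p + s *\<^sub>R d)" "\<lambda>s r. r *\<^sub>R ?D s d"])
    fix s assume s: "s \<in> {a..b}"
    have D: "(f has_derivative ?D s) (at (p + s *\<^sub>R d))"
      by (rule C1_on_has_derivative[OF f line[OF s]])
    have "((\<lambda>s. p + s *\<^sub>R d) has_derivative (\<lambda>r. r *\<^sub>R d)) (at s)"
      by (auto intro!: derivative_eq_intros)
    from diff_chain_at[OF this D]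
    have "((\<lambda>s. f (p + s *\<^sub>R d)) has_derivative (\<lambda>r. ?D s (r *\<^sub>R d))) (at s)"
      by (simp add: o_def)
    moreover have "linear (?D s)" using D has_derivative_linear by blast
    ultimately show "((\<lambda>s. f (p + s *\<^sub>R d)) has_derivative (\<lambda>r. r *\<^sub>R ?D s d)) (at s within {a..b})"
      by (auto simp: linear_scale intro: has_derivative_at_withinI)
    show "onorm (\<lambda>r. r *\<^sub>R ?D s d) \<le> B"
      using B[OF s] by (intro onorm_le) (simp add: mult_left_mono mult.commute[of B])
  qed (use st in auto)
  then show ?thesis using st by simp
qed

text \<open>On a compact rectangle the differential is bounded, so the restriction to each horizontal or
  vertical segment is Lipschitz.\<close>

lemma C1_on_imp_ACL_on:
  assumes f: "Ck_on (Suc 0) f W"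
  shows "ACL_on W f"
  unfolding ACL_on_def
proof (intro allI impI)
  fix a b :: complex assume box: "cbox a b \<subseteq> W"
  have "\<exists>B. \<forall>z\<in>cbox a b. norm (frechet_derivative f (at z) v) \<le> B" for v
  proof -
    have "continuous_on (cbox a b) (\<lambda>z. frechet_derivative f (at z) v)"
      using f box by (auto intro: continuous_on_subset)
    then have "compact ((\<lambda>z. frechet_derivative f (at z) v) ` cbox a b)"
      by (rule compact_continuous_image) simp
    then show ?thesis using compact_imp_bounded bounded_iff by (metis (no_types, lifting) imageI)
  qed
  then obtain B where B: "\<And>v z. z \<in> cbox a b \<Longrightarrow> norm (frechet_derivative f (at z) v) \<le> B v"
    by metis
  have eq: "Complex x y = \<i> * y + x *\<^sub>R 1" "Complex x y = of_real x + y *\<^sub>R \<i>" for x y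
    by (simp_all add: complex_eq_iff)
  have mem: "Complex x y \<in> cbox a b \<longleftrightarrow> x \<in> {Re a..Re b} \<and> y \<in> {Im a..Im b}" for x y
    by (auto simp: in_cbox_complex_iff)
  have "abs_continuous_on (Re a) (Re b) (\<lambda>x. f (Complex x y))" if "y \<in> {Im a..Im b}" for y
  proof (rule lipschitz_imp_abs_continuous_on)
    fix s t assume st: "Re a \<le> s" "s \<le> t" "t \<le> Re b"
    show "cmod (f (Complex t y) - f (Complex s y)) \<le> B 1 * (t - s)"
      unfolding eq(1)
      by (rule C1_on_lipschitz_on_line[OF f, of "Re a" "Re b"])
        (use that st B box mem in \<open>auto simp: eq(1)[symmetric]\<close>)
  qed
  moreover have "abs_continuous_on (Im a) (Im b) (\<lambda>y. f (Complex x y))" if "x \<in> {Re a..Re b}" for x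
  proof (rule lipschitz_imp_abs_continuous_on)
    fix s t assume st: "Im a \<le> s" "s \<le> t" "t \<le> Im b"
    show "cmod (f (Complex x t) - f (Complex x s)) \<le> B \<i> * (t - s)"
      unfolding eq(2)
      by (rule C1_on_lipschitz_on_line[OF f, of "Im a" "Im b"])
        (use that st B box mem in \<open>auto simp: eq(2)[symmetric]\<close>)
  qed
  ultimately show "(AE y in lebesgue. y \<in> {Im a..Im b} \<longrightarrow> abs_continuous_on (Re a) (Re b) (\<lambda>x. f (Complex x y))) \<and>
    (AE x in lebesgue. x \<in> {Re a..Re b} \<longrightarrow> abs_continuous_on (Im a) (Im b) (\<lambda>y. f (Complex x y)))"
    by auto
qed

text \<open>Write \<open>D v = P v + Q cnj v\<close>. Then \<open>D\<close> stretches by \<open>\<bar>P\<bar> + \<bar>Q\<bar>\<close> in the direction of a square root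
  of \<open>Q cnj P\<close>, which aligns the two terms, and by \<open>\<bar>P\<bar> - \<bar>Q\<bar>\<close> in the perpendicular direction. The
  determinant is \<open>\<bar>P\<bar>\<^sup>2 - \<bar>Q\<bar>\<^sup>2\<close>, so the second number is positive.\<close>

lemma linear_dilatation_le:
  fixes D :: "complex \<Rightarrow> complex"
  assumes lin: "linear D" and det: "Im (cnj (D 1) * D \<i>) > 0" and K: "K \<ge> 1"
    and stretch: "\<And>u v. cmod u = cmod v \<Longrightarrow> cmod (D u) \<le> K * cmod (D v)"
  shows "cmod ((D 1 + \<i> * D \<i>) / 2) \<le> (K - 1) / (K + 1) * cmod ((D 1 - \<i> * D \<i>) / 2)"
proof -
  define P Q where "P = (D 1 - \<i> * D \<i>) / 2" and "Q = (D 1 + \<i> * D \<i>) / 2"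
  have D: "D v = P * v + Q * cnj v" for v
  proof -
    have "v = Re v *\<^sub>R 1 + Im v *\<^sub>R \<i>" by (simp add: complex_eq_iff)
    then have "D v = D (Re v *\<^sub>R 1 + Im v *\<^sub>R \<i>)" by simp
    also have "\<dots> = Re v *\<^sub>R D 1 + Im v *\<^sub>R D \<i>" by (simp add: linear_add[OF lin] linear_scale[OF lin])
    also have "\<dots> = P * v + Q * cnj v"
      by (simp add: P_def Q_def complex_eq_iff field_simps)
    finally show ?thesis .
  qed
  have "(cmod P)\<^sup>2 - (cmod Q)\<^sup>2 = Im (cnj (D 1) * D \<i>)"
    unfolding D cmod_power2 by (simp add: power2_eq_square algebra_simps)
  then have "(cmod Q)\<^sup>2 < (cmod P)\<^sup>2" using det by simp
  then have less: "cmod Q < cmod P" by (rule power2_less_imp_less) simp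
  have "cmod P + cmod Q \<le> K * (cmod P - cmod Q)" if "Q \<noteq> 0"
  proof -
    define u where "u = csqrt (Q * cnj P)"
    have u2: "u\<^sup>2 = Q * cnj P" by (simp add: u_def)
    have nu: "(cmod u)\<^sup>2 = cmod P * cmod Q"
      using arg_cong[OF u2, of cmod] by (simp add: norm_power norm_mult mult.commute)
    have c: "Re ((P * u) * cnj (Q * cnj u)) = (cmod P)\<^sup>2 * (cmod Q)\<^sup>2"
    proof -
      have "(P * u) * cnj (Q * cnj u) = (P * cnj P) * (Q * cnj Q)"
        using u2 by (simp add: power2_eq_square mult_ac)
      also have "\<dots> = of_real ((cmod P)\<^sup>2 * (cmod Q)\<^sup>2)" by (simp only: of_real_mult complex_norm_square)
      finally show ?thesis by (metis Re_complex_of_real)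
    qed
    have sq: "(cmod (x + y))\<^sup>2 = (cmod x)\<^sup>2 + (cmod y)\<^sup>2 + 2 * Re (x * cnj y)"
      "(cmod (x - y))\<^sup>2 = (cmod x)\<^sup>2 + (cmod y)\<^sup>2 - 2 * Re (x * cnj y)" for x y
      unfolding cmod_power2 by (simp_all add: power2_eq_square algebra_simps)
    have 1: "(cmod (D u))\<^sup>2 = cmod P * cmod Q * (cmod P + cmod Q)\<^sup>2"
      unfolding D sq c by (simp add: norm_mult power_mult_distrib nu)
        (simp add: power2_eq_square algebra_simps)
    have "D (\<i> * u) = \<i> * (P * u - Q * cnj u)" by (simp add: D algebra_simps)
    then have "cmod (D (\<i> * u)) = cmod (P * u - Q * cnj u)" by (simp add: norm_mult)
    then have "(cmod (D (\<i> * u)))\<^sup>2 = (cmod (P * u - Q * cnj u))\<^sup>2" by simp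
    then have 2: "(cmod (D (\<i> * u)))\<^sup>2 = cmod P * cmod Q * (cmod P - cmod Q)\<^sup>2"
      unfolding sq c by (simp add: norm_mult power_mult_distrib nu)
        (simp add: power2_eq_square algebra_simps)
    have "cmod (D u) \<le> K * cmod (D (\<i> * u))" by (rule stretch) (simp add: norm_mult)
    then have "(cmod (D u))\<^sup>2 \<le> (K * cmod (D (\<i> * u)))\<^sup>2" by (intro power_mono) auto
    then have "cmod P * cmod Q * (cmod P + cmod Q)\<^sup>2 \<le> cmod P * cmod Q * (K * (cmod P - cmod Q))\<^sup>2"
      by (simp add: power_mult_distrib 1 2 mult_ac)
    moreover have "cmod P * cmod Q > 0" using that less order_le_less_trans[OF norm_ge_zero less] by (intro mult_pos_pos) auto
    ultimately have "(cmod P + cmod Q)\<^sup>2 \<le> (K * (cmod P - cmod Q))\<^sup>2"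
      by (rule mult_left_le_imp_le)
    then show ?thesis by (rule power2_le_imp_le) (use K less in simp)
  qed
  then have "(K + 1) * cmod Q \<le> (K - 1) * cmod P"
    using K mult_right_mono[of 1 K "cmod P"] by (cases "Q = 0") (auto simp: algebra_simps)
  then show ?thesis
    using K unfolding P_def[symmetric] Q_def[symmetric] by (simp add: field_simps)
qed

lemma C1_on_imp_quasiconformal_on:
  assumes f: "Ck_on (Suc 0) f W" and hom: "homeomorphism W (f ` W) f g" and K: "K \<ge> 1"
    and det: "\<And>z. z \<in> W \<Longrightarrow> Im (cnj (frechet_derivative f (at z) 1) * frechet_derivative f (at z) \<i>) > 0"
    and stretch: "\<And>z u v. z \<in> W \<Longrightarrow> cmod u = cmod v \<Longrightarrow>
      cmod (frechet_derivative f (at z) u) \<le> K * cmod (frechet_derivative f (at z) v)"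
  shows "quasiconformal_on K W f"
  unfolding quasiconformal_on_def
proof (intro conjI AE_I2 impI)
  show "\<exists>g. homeomorphism W (f ` W) f g" using hom by blast
  show "ACL_on W f" by (rule C1_on_imp_ACL_on[OF f])
  fix z assume z: "z \<in> W"
  let ?D = "frechet_derivative f (at z)"
  have D: "(f has_derivative ?D) (at z)" by (rule C1_on_has_derivative[OF f z])
  then have lin: "linear ?D" by (rule has_derivative_linear)
  have "((\<lambda>t. f (z + d * of_real t)) has_vector_derivative ?D d) (at 0)" for d
  proof -
    have "((\<lambda>t. z + d * complex_of_real t) has_derivative (\<lambda>r. r *\<^sub>R d)) (at 0)"
      by (auto intro!: derivative_eq_intros simp: scaleR_conv_of_real)
    from diff_chain_at[OF this, of f ?D] D show ?thesis
      by (simp add: o_def has_vector_derivative_def linear_scale[OF lin])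
  qed
  from this[of 1] this[of \<i>] linear_dilatation_le[OF lin det[OF z] K stretch[OF z]]
  show "\<exists>fx fy. ((\<lambda>t. f (z + of_real t)) has_vector_derivative fx) (at 0) \<and>
                ((\<lambda>t. f (z + \<i> * of_real t)) has_vector_derivative fy) (at 0) \<and>
                cmod ((fx + \<i> * fy) / 2) \<le> (K - 1) / (K + 1) * cmod ((fx - \<i> * fy) / 2)"
    by auto
qed

text \<open>Dilatations are at least 1. This bounds from below the sets whose infima define the distance, so
  that the infima are at most each element, and it keeps the logarithm in its monotone range.\<close>

lemma teichmueller_dist_le_identity:
  assumes "quasiconformal_map X \<sigma>1 \<sigma>2 K id"
  shows "teichmueller_dist X \<sigma>1 \<sigma>2 \<le> 1 / 2 * ln K"
proof -
  let ?S = "{maximal_dilatation X \<sigma>1 \<sigma>2 f | f.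
     (\<exists>K. quasiconformal_map X \<sigma>1 \<sigma>2 K f) \<and> homotopic_with (\<lambda>_. True) X X f id}"
  have bdd: "bdd_below {K. quasiconformal_map X \<sigma>1 \<sigma>2 K f}" for f
    by (auto simp: bdd_below_def quasiconformal_map_def)
  have ge: "x \<ge> 1" if "x \<in> ?S" for x
    using that unfolding maximal_dilatation_def
    by (auto intro!: cInf_greatest simp: quasiconformal_map_def)
  have id: "maximal_dilatation X \<sigma>1 \<sigma>2 id \<in> ?S"
    using assms by auto
  have "Inf ?S \<le> maximal_dilatation X \<sigma>1 \<sigma>2 id"
    by (intro cInf_lower id bdd_belowI[of _ 1] ge)
  also have "\<dots> \<le> K"
    unfolding maximal_dilatation_def using assms bdd by (intro cInf_lower) auto
  finally have "Inf ?S \<le> K" .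
  moreover have "1 \<le> Inf ?S" using id ge by (intro cInf_greatest) auto
  ultimately show ?thesis unfolding teichmueller_dist_def by simp
qed

section \<open>Isometries of hyperbolic space\<close>

lemma mink_polarization: "mink X Y = (mink (X + Y) (X + Y) - mink X X - mink Y Y) / 2"
proof -
  interpret M: bounded_bilinear mink by (rule bounded_bilinear_mink)
  show ?thesis by (simp add: M.add_left M.add_right mink_commute[of Y X])
qed

lemma moebius_component:
  "moebius A X $ i $ j = (A$i$1 * X$1$1 + A$i$2 * X$2$1) * cnj (A$j$1) + (A$i$1 * X$1$2 + A$i$2 * X$2$2) * cnj (A$j$2)"
  by (simp add: moebius_def matrix_matrix_mult_def sum_2 adj_def)

lemma bounded_linear_moebius: "bounded_linear (moebius A)"
proof -
  have "moebius A (X + Y) $ i $ j = moebius A X $ i $ j + moebius A Y $ i $ j"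
    and "moebius A (r *\<^sub>R X) $ i $ j = r *\<^sub>R moebius A X $ i $ j" for X Y r i j
    unfolding moebius_component by (simp_all add: scaleR_right_distrib ring_distribs)
  then show ?thesis
    unfolding linear_conv_bounded_linear[symmetric] by (intro linearI) (simp_all add: vec_eq_iff)
qed

lemma mink_moebius:
  assumes "A \<in> SL2C"
  shows "mink (moebius A X) (moebius A Y) = mink X Y"
proof -
  have "det (adj A) = cnj (det A)" by (simp add: det_2 adj_def)
  then have "mink (moebius A X) (moebius A X) = mink X X" for X
    using assms by (simp add: mink_self moebius_def det_mul SL2C_def)
  moreover have "moebius A X + moebius A Y = moebius A (X + Y)"
    using linear_add[OF bounded_linear.linear[OF bounded_linear_moebius]] by metis
  ultimately show ?thesis
    using mink_polarization[of "moebius A X" "moebius A Y"] mink_polarization[of X Y] by simp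
qed

text \<open>The form \<open>mink\<close> only determines the two-sheeted hyperboloid. That the upper sheet is preserved is seen by
  completing the square in the first diagonal entry.\<close>

lemma moebius_H3:
  assumes A: "A \<in> SL2C" and p: "p \<in> H3"
  shows "moebius A p \<in> H3"
proof -
  have h: "hermitian p" using p by (simp add: H3_iff)
  have "adj (adj A) = A" by (simp add: adj_def vec_eq_iff)
  then have herm: "hermitian (moebius A p)"
    using h by (simp add: hermitian_def moebius_def adj_mult matrix_mul_assoc)
  define x d b a1 a2 where "x = Re (p$1$1)" and "d = Re (p$2$2)" and "b = p$1$2"
    and "a1 = A$1$1" and "a2 = A$1$2"
  have P: "p$1$1 = of_real x" "p$2$2 = of_real d" "p$1$2 = b" "p$2$1 = cnj b"
    using h by (auto simp: hermitian_iff x_def d_def b_def complex_eq_iff)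
  have x: "x > 0" using p by (simp add: H3_iff x_def)
  have det: "x * d - (cmod b)\<^sup>2 = 1"
    using mink_H3[OF p] unfolding mink_eq P cmod_power2 by (simp add: power2_eq_square algebra_simps)
  have "a1 \<noteq> 0 \<or> a2 \<noteq> 0"
    using A by (auto simp: SL2C_def det_2 a1_def a2_def)
  moreover have "x * Re (moebius A p $ 1 $ 1) = (cmod (x * a1 + cnj b * a2))\<^sup>2 + (x * d - (cmod b)\<^sup>2) * (cmod a2)\<^sup>2"
    unfolding cmod_power2 moebius_component P a1_def[symmetric] a2_def[symmetric]
    by (simp add: power2_eq_square algebra_simps)
  moreover have "(cmod (x * a1 + cnj b * a2))\<^sup>2 + (cmod a2)\<^sup>2 > 0" if "a1 \<noteq> 0 \<or> a2 \<noteq> 0"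
    using that x by (cases "a2 = 0") (simp_all add: add_nonneg_pos)
  ultimately have "x * Re (moebius A p $ 1 $ 1) > 0" using det by simp
  then have "Re (moebius A p $ 1 $ 1) > 0" using x by (simp add: zero_less_mult_iff)
  moreover have "mink (moebius A p) (moebius A p) = -1"
    unfolding mink_moebius[OF A] by (rule mink_H3[OF p])
  ultimately show ?thesis unfolding H3_iff using herm by simp
qed

lemma discrete_imp_countable:
  fixes S :: "'a::second_countable_topology set"
  assumes "discrete S"
  shows "countable S"
proof -
  obtain \<B> :: "'a set set" where \<B>: "countable \<B>" "topological_basis \<B>"
    using ex_countable_basis by blast
  have "\<exists>B\<in>\<B>. B \<inter> S = {x}" if x: "x \<in> S" for x
  proof -
    obtain T where "open T" "T \<inter> S = {x}"
      using assms x by (auto simp: discrete_def isolated_in_def)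
    moreover from this x have "x \<in> T" by blast
    ultimately obtain B where "B \<in> \<B>" "x \<in> B" "B \<subseteq> T" using topological_basisE[OF \<B>(2)] by metis
    then show ?thesis using \<open>T \<inter> S = {x}\<close> x by (intro bexI[of _ B]) auto
  qed
  then obtain B where B: "\<And>x. x \<in> S \<Longrightarrow> B x \<in> \<B> \<and> B x \<inter> S = {x}" by metis
  have "inj_on B S"
  proof (rule inj_onI)
    fix x y assume "x \<in> S" "y \<in> S" "B x = B y"
    then have "{x} = {y}" using B by metis
    then show "x = y" by simp
  qed
  moreover have "countable (B ` S)" using B by (intro countable_subset[OF _ \<B>(1)]) auto
  ultimately show ?thesis by (rule countable_image_inj_on[rotated])
qed

locale kleinian_group =
  fixes \<Gamma> :: "(mat2 \<Rightarrow> mat2) set"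
  assumes kleinian: "kleinian \<Gamma>"
begin

lemma group_element_moebius: "\<gamma> \<in> \<Gamma> \<Longrightarrow> \<exists>A\<in>SL2C. \<gamma> = moebius A"
  using kleinian subgroup.subset[of \<Gamma> PSL2C] by (auto simp: kleinian_def PSL2C_def)

lemma group_element_bounded_linear: "\<gamma> \<in> \<Gamma> \<Longrightarrow> bounded_linear \<gamma>"
  using group_element_moebius bounded_linear_moebius by blast

lemma group_element_mink: "\<gamma> \<in> \<Gamma> \<Longrightarrow> mink (\<gamma> X) (\<gamma> Y) = mink X Y"
  using group_element_moebius mink_moebius by blast

lemma group_element_H3: "\<gamma> \<in> \<Gamma> \<Longrightarrow> p \<in> H3 \<Longrightarrow> \<gamma> p \<in> H3"
  using group_element_moebius moebius_H3 by blast

lemma id_in_group: "id \<in> \<Gamma>"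
  using kleinian subgroup.one_closed[of \<Gamma> PSL2C] by (simp add: kleinian_def PSL2C_def)

lemma comp_in_group: "\<gamma> \<in> \<Gamma> \<Longrightarrow> \<delta> \<in> \<Gamma> \<Longrightarrow> \<gamma> \<circ> \<delta> \<in> \<Gamma>"
  using kleinian subgroup.m_closed[of \<Gamma> PSL2C \<gamma> \<delta>] by (simp add: kleinian_def PSL2C_def)

lemma group_inverse: "\<gamma> \<in> \<Gamma> \<Longrightarrow> \<exists>\<delta>\<in>\<Gamma>. \<delta> \<circ> \<gamma> = id"
proof -
  assume \<gamma>: "\<gamma> \<in> \<Gamma>"
  have sub: "subgroup \<Gamma> PSL2C" using kleinian by (simp add: kleinian_def)
  have "inv\<^bsub>PSL2C\<^esub> \<gamma> \<in> \<Gamma>" by (rule subgroup.m_inv_closed[OF sub \<gamma>])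
  moreover have "inv\<^bsub>PSL2C\<^esub> \<gamma> \<otimes>\<^bsub>PSL2C\<^esub> \<gamma> = \<one>\<^bsub>PSL2C\<^esub>"
    using group.l_inv[OF group_PSL2C] subgroup.mem_carrier[OF sub \<gamma>] by blast
  ultimately show ?thesis by (auto simp: PSL2C_def)
qed

lemma orbit_refl: "x \<in> orbit_of \<Gamma> x"
  unfolding orbit_of_def by (rule image_eqI[OF _ id_in_group]) simp

lemma orbit_group_element: "\<gamma> \<in> \<Gamma> \<Longrightarrow> orbit_of \<Gamma> (\<gamma> x) = orbit_of \<Gamma> x"
proof -
  assume \<gamma>: "\<gamma> \<in> \<Gamma>"
  obtain \<delta> where \<delta>: "\<delta> \<in> \<Gamma>" "\<delta> \<circ> \<gamma> = id" using group_inverse[OF \<gamma>] by blast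
  have "\<eta> (\<gamma> x) \<in> orbit_of \<Gamma> x" if "\<eta> \<in> \<Gamma>" for \<eta>
    unfolding orbit_of_def by (rule image_eqI[OF _ comp_in_group[OF that \<gamma>]]) simp
  moreover have "\<eta> x \<in> orbit_of \<Gamma> (\<gamma> x)" if "\<eta> \<in> \<Gamma>" for \<eta>
  proof -
    have "\<eta> x = (\<eta> \<circ> \<delta>) (\<gamma> x)" using fun_cong[OF \<delta>(2), of x] by simp
    then show ?thesis
      unfolding orbit_of_def by (rule image_eqI[OF _ comp_in_group[OF that \<delta>(1)]])
  qed
  ultimately show ?thesis by (auto simp: orbit_of_def)
qed

lemma countable_group: "countable \<Gamma>"
proof -
  let ?L = "{A \<in> SL2C. moebius A \<in> \<Gamma>}"
  have "countable ?L"
    using kleinian by (intro discrete_imp_countable) (simp add: kleinian_def)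
  moreover have "\<Gamma> \<subseteq> moebius ` ?L" using group_element_moebius by blast
  ultimately show ?thesis by (meson countable_image countable_subset)
qed

end

section \<open>Orthonormal frames of Minkowski space\<close>

text \<open>The reversed Cauchy--Schwarz inequality. In matrix entries, with diagonals \<open>a, d\<close> of \<open>p\<close> and \<open>x, y\<close> of
  \<open>X\<close>, orthogonality and the ordinary inequality for the off-diagonal entries (\<open>c\<close> that of \<open>X\<close>) give
  \<open>4 \<bar>c\<bar>\<^sup>2 + (a y - d x)\<^sup>2 \<le> 4 a d mink X X\<close>, and the left-hand side vanishes only for \<open>X = 0\<close>.\<close>

lemma mink_positive_definite:
  assumes p: "p \<in> H3" and X: "hermitian X" "mink p X = 0" "X \<noteq> 0"
  shows "mink X X > 0"
proof -
  have hp: "hermitian p" using p by (simp add: H3_iff)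
  define a d b where "a = Re (p$1$1)" and "d = Re (p$2$2)" and "b = p$1$2"
  define x y c where "x = Re (X$1$1)" and "y = Re (X$2$2)" and "c = X$1$2"
  have P: "p$1$1 = of_real a" "p$2$2 = of_real d" "p$1$2 = b" "p$2$1 = cnj b"
    using hp by (auto simp: hermitian_iff a_def d_def b_def complex_eq_iff)
  have Q: "X$1$1 = of_real x" "X$2$2 = of_real y" "X$1$2 = c" "X$2$1 = cnj c"
    using X(1) by (auto simp: hermitian_iff x_def y_def c_def complex_eq_iff)
  have a: "a > 0" using p by (simp add: H3_iff a_def)
  have det: "a * d - (cmod b)\<^sup>2 = 1"
    using mink_H3[OF p] unfolding mink_eq P cmod_power2 by (simp add: power2_eq_square algebra_simps)
  have "a * d > 0" using det by (smt (verit) zero_le_power2)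
  then have d: "d > 0" using a by (simp add: zero_less_mult_iff)
  define t where "t = Re (b * cnj c)"
  have orth: "a * y + d * x = 2 * t"
    using X(2) unfolding mink_eq P Q t_def by (simp add: algebra_simps)
  have XX: "mink X X = (cmod c)\<^sup>2 - x * y"
    unfolding mink_eq Q cmod_power2 by (simp add: power2_eq_square)
  have "t\<^sup>2 \<le> (cmod (b * cnj c))\<^sup>2"
    unfolding cmod_power2 t_def by simp
  also have "\<dots> = (a * d - 1) * (cmod c)\<^sup>2"
    using det by (simp add: norm_mult power_mult_distrib algebra_simps)
  finally have "(a * y + d * x)\<^sup>2 \<le> 4 * ((a * d - 1) * (cmod c)\<^sup>2)"
    unfolding orth by (simp add: power_mult_distrib)
  then have key: "4 * (cmod c)\<^sup>2 + (a * y - d * x)\<^sup>2 \<le> 4 * (a * d) * mink X X"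
    by (simp add: XX power2_eq_square algebra_simps)
  show ?thesis
  proof (rule ccontr)
    assume "\<not> mink X X > 0"
    then have "4 * (a * d) * mink X X \<le> 0" using \<open>a * d > 0\<close> by (intro mult_nonneg_nonpos) auto
    then have "4 * (cmod c)\<^sup>2 + (a * y - d * x)\<^sup>2 \<le> 0" using key by linarith
    then have "(cmod c)\<^sup>2 = 0 \<and> (a * y - d * x)\<^sup>2 = 0"
      by (smt (verit) zero_le_power2)
    then have c: "c = 0" and "a * y = d * x" by auto
    moreover have "t = 0" using c by (simp add: t_def)
    ultimately have "a * y = 0" "d * x = 0" using orth by auto
    then have "x = 0" "y = 0" using a d by auto
    then have "X = 0" using c Q by (simp add: vec_eq_iff forall_2)
    then show False using X(3) by simp
  qed
qed

text \<open>A nonzero \<open>X\<close> would complete the frame to five mutually orthogonal vectors, none of them null and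
  hence linearly independent, in the space of Hermitian matrices, which has dimension 4.\<close>

lemma orthogonal_to_frame_imp_zero:
  assumes p: "p \<in> H3" and h: "hermitian n" "hermitian e1" "hermitian e2" "hermitian X"
    and pn: "mink p n = 0" "mink p e1 = 0" "mink p e2 = 0" "mink n n = 1" "mink n e1 = 0" "mink n e2 = 0"
      "mink e1 e1 = 1" "mink e1 e2 = 0" "mink e2 e2 = 1"
    and X: "mink p X = 0" "mink n X = 0" "mink e1 X = 0" "mink e2 X = 0"
  shows "X = 0"
proof (rule ccontr)
  assume "X \<noteq> 0"
  interpret M: bounded_bilinear mink by (rule bounded_bilinear_mink)
  have XX: "mink X X > 0" by (rule mink_positive_definite[OF p h(4) X(1) \<open>X \<noteq> 0\<close>])
  have pp: "mink p p = -1" and hp: "hermitian p" using p by (auto simp: H3_iff)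
  have sym: "mink n p = 0" "mink e1 p = 0" "mink e2 p = 0" "mink X p = 0" "mink e1 n = 0" "mink e2 n = 0"
      "mink X n = 0" "mink e2 e1 = 0" "mink X e1 = 0" "mink X e2 = 0"
    using pn X by (metis mink_commute)+
  (* The linear combinations of the five vectors, followed by Hermitian coordinates: an injective
     linear map from dimension 5 to dimension 4. *)
  define Y where "Y = (\<lambda>(a, b, c, d, e). a *\<^sub>R p + b *\<^sub>R n + c *\<^sub>R e1 + d *\<^sub>R e2 + e *\<^sub>R X)"
  define F where "F v = (Re (Y v $ 1 $ 1), Re (Y v $ 2 $ 2), Y v $ 1 $ 2)" for v
  have linY: "Y (u + v) = Y u + Y v" "Y (r *\<^sub>R v) = r *\<^sub>R Y v" for u v r
    by (auto simp: Y_def case_prod_unfold algebra_simps)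
  have lin: "linear F"
    by (rule linearI) (simp_all add: F_def linY)
  have hY: "hermitian (Y v)" for v
    using h hp by (auto simp: Y_def case_prod_unfold hermitian_iff)
  have "inj F"
    unfolding linear_injective_0[OF lin]
  proof (intro allI impI)
    fix v assume "F v = 0"
    then have "Y v = 0" using hY[of v]
      by (auto simp: F_def hermitian_iff vec_eq_iff forall_2 complex_eq_iff zero_prod_def)
    obtain a b c d e where v: "v = (a, b, c, d, e)" by (rule prod_cases5)
    have "mink q (Y v) = 0" for q using \<open>Y v = 0\<close> by (simp add: M.zero_right)
    from this[of p] this[of n] this[of e1] this[of e2] this[of X]
    have "a = 0 \<and> b = 0 \<and> c = 0 \<and> d = 0 \<and> e = 0"
      using XX X pn pp sym by (simp add: v Y_def M.add_right M.scaleR_right)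
    then show "v = 0" by (simp add: v zero_prod_def)
  qed
  then have "dim (range F) = DIM(real \<times> real \<times> real \<times> real \<times> real)"
    using dim_image_eq[OF lin, of UNIV] by simp
  moreover have "dim (range F) \<le> DIM(real \<times> real \<times> complex)" by (rule dim_subset_UNIV)
  ultimately show False by simp
qed

text \<open>Think of \<open>D\<close> and \<open>N\<close> as the differentials of an immersion and of its unit normal \<open>n\<close> at a point. In
  a basis \<open>e1, e2\<close> that is orthonormal for the first form, the trace-free symmetric second form has the
  matrix with rows \<open>(P, Q)\<close> and \<open>(Q, -P)\<close>, where \<open>P = \<mu> cos 2\<theta>\<close> and \<open>Q = \<mu> sin 2\<theta>\<close>; rotation of the
  basis by \<open>\<theta>\<close> diagonalizes it. The vectors \<open>p, n, D w1, D w2\<close> form a frame, so a Hermitian matrix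
  orthogonal to \<open>p\<close> and \<open>n\<close> is determined by its products with \<open>D w1\<close> and \<open>D w2\<close>; thus the
  diagonal form of the second form gives the eigenvector equations for \<open>N\<close>.\<close>

lemma shape_operator_diagonalization:
  fixes D N :: "complex \<Rightarrow> mat2"
  assumes p: "p \<in> H3" and n: "hermitian n" "mink p n = 0" "mink n n = 1"
    and lin: "linear D" "linear N" and inj: "inj D"
    and D: "\<And>v. hermitian (D v)" "\<And>v. mink p (D v) = 0" "\<And>v. mink n (D v) = 0"
    and N: "\<And>v. hermitian (N v)" "\<And>v. mink p (N v) = 0" "\<And>v. mink n (N v) = 0"
    and sym: "\<And>v w. mink (N v) (D w) = mink (N w) (D v)"
    and trace: "mink (N 1) (D 1) * mink (D \<i>) (D \<i>) - 2 * mink (N 1) (D \<i>) * mink (D 1) (D \<i>)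
      + mink (N \<i>) (D \<i>) * mink (D 1) (D 1) = 0"
  obtains \<mu> w1 w2 where "\<mu> \<ge> 0" "mink (D w1) (D w1) = 1" "mink (D w1) (D w2) = 0" "mink (D w2) (D w2) = 1"
    "N w1 = - \<mu> *\<^sub>R D w1" "N w2 = \<mu> *\<^sub>R D w2" "\<And>v. \<exists>x y. v = x *\<^sub>R w1 + y *\<^sub>R w2"
proof -
  interpret M: bounded_bilinear mink by (rule bounded_bilinear_mink)
  note linD = linear_add[OF lin(1)] linear_scale[OF lin(1)] linear_diff[OF lin(1)] linear_neg[OF lin(1)]
  note linN = linear_add[OF lin(2)] linear_scale[OF lin(2)] linear_diff[OF lin(2)] linear_neg[OF lin(2)]
  note bil = M.add_left M.add_right M.scaleR_left M.scaleR_right M.diff_left M.diff_right M.minus_left M.minus_right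
  have pos: "mink (D v) (D v) > 0" if "v \<noteq> 0" for v
  proof -
    have "D v \<noteq> 0" using inj linear_0[OF lin(1)] that by (metis injD)
    then show ?thesis using mink_positive_definite[OF p D(1,2)] by blast
  qed
  define G F H where "G = mink (D 1) (D 1)" and "F = mink (D 1) (D \<i>)" and "H = mink (D \<i>) (D \<i>)"
  have F': "mink (D \<i>) (D 1) = F" by (simp add: F_def mink_commute)
  have G: "G > 0" using pos[of 1] by (simp add: G_def)
  (* Gram--Schmidt applied to 1 and \<i>; J is the squared length of the component of \<i> orthogonal to 1. *)
  define J where "J = H - F * F / G"
  define u where "u = \<i> - (F / G) *\<^sub>R 1"
  have gu: "mink (D 1) (D u) = 0" "mink (D u) (D u) = J"
    using G by (simp_all add: u_def linD bil F' F_def[symmetric] G_def[symmetric] H_def[symmetric] J_def field_simps)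
  have "u \<noteq> 0" by (simp add: u_def complex_eq_iff)
  then have J: "J > 0" using pos[of u] gu by simp
  define e1 where "e1 = (1 / sqrt G) *\<^sub>R (1::complex)"
  define e2 where "e2 = (1 / sqrt J) *\<^sub>R u"
  have g: "mink (D e1) (D e1) = 1" "mink (D e1) (D e2) = 0" "mink (D e2) (D e2) = 1"
  proof -
    show "mink (D e1) (D e1) = 1" using G by (simp add: e1_def linD bil G_def[symmetric])
    show "mink (D e1) (D e2) = 0" by (simp add: e1_def e2_def linD bil gu)
    show "mink (D e2) (D e2) = 1" using J by (simp add: e2_def linD bil gu)
  qed
  define P Q where "P = - mink (N e1) (D e1)" and "Q = - mink (N e1) (D e2)"
  have b21: "mink (N e2) (D e1) = - Q" using sym[of e2 e1] by (simp add: Q_def)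
  have b22: "mink (N e2) (D e2) = P"
  proof -
    define B C E where "B = mink (N 1) (D 1)" and "C = mink (N 1) (D \<i>)" and "E = mink (N \<i>) (D \<i>)"
    have C': "mink (N \<i>) (D 1) = C" using sym[of \<i> 1] by (simp add: C_def)
    have tr: "B * H - 2 * C * F + E * G = 0"
      using trace by (simp add: B_def C_def E_def F_def G_def H_def)
    have "P = - (B / G)" using G by (simp add: P_def e1_def linD linN bil B_def[symmetric])
    moreover have "mink (N u) (D u) = - (B / G) * J"
    proof -
      have "mink (N u) (D u) = E - 2 * (F / G) * C + (F / G) * (F / G) * B"
        by (simp add: u_def linD linN bil C' B_def[symmetric] C_def[symmetric] E_def[symmetric] algebra_simps)
      moreover have "E = (2 * C * F - B * H) / G" using tr G by (simp add: field_simps)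
      ultimately show ?thesis using G by (simp add: J_def field_simps)
    qed
    ultimately show ?thesis using J by (simp add: e2_def linD linN bil) (simp add: mult.assoc[symmetric])
  qed
  define \<mu> where "\<mu> = cmod (Complex P Q)"
  define \<theta> where "\<theta> = Arg (Complex P Q) / 2"
  have "Complex P Q = \<mu> * cis (2 * \<theta>)"
    using rcis_cmod_Arg[of "Complex P Q"] by (simp add: \<mu>_def \<theta>_def rcis_def)
  then have PQ: "P = \<mu> * cos (2 * \<theta>)" "Q = \<mu> * sin (2 * \<theta>)" by (auto simp: complex_eq_iff)
  define c s where "c = cos \<theta>" and "s = sin \<theta>"
  have cs: "c * c + s * s = 1" by (simp add: c_def s_def flip: power2_eq_square)
  have P: "P = \<mu> * (c * c - s * s)" and Q: "Q = \<mu> * (2 * s * c)"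
    using PQ by (simp_all add: cos_double sin_double c_def s_def power2_eq_square)
  define w1 w2 where "w1 = c *\<^sub>R e1 + s *\<^sub>R e2" and "w2 = c *\<^sub>R e2 - s *\<^sub>R e1"
  have g21: "mink (D e2) (D e1) = 0" using g(2) by (simp add: mink_commute)
  have gw: "mink (D w1) (D w1) = 1" "mink (D w1) (D w2) = 0" "mink (D w2) (D w2) = 1"
    using cs by (simp_all add: w1_def w2_def linD bil g g21 algebra_simps)
  have b11: "mink (N e1) (D e1) = - P" "mink (N e1) (D e2) = - Q" by (simp_all add: P_def Q_def)
  have bw: "mink (N w1) (D w1) = - \<mu>" "mink (N w1) (D w2) = 0" "mink (N w2) (D w2) = \<mu>"
  proof -
    have 1: "(c * c - s * s) * (c * c - s * s) + 4 * (c * c) * (s * s) = 1"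
    proof -
      have "(c * c - s * s) * (c * c - s * s) + 4 * (c * c) * (s * s) = (c * c + s * s) * (c * c + s * s)"
        by (simp add: algebra_simps)
      then show ?thesis by (simp add: cs)
    qed
    have "mink (N w1) (D w1) = - \<mu> * ((c * c - s * s) * (c * c - s * s) + 4 * (c * c) * (s * s))"
      by (simp add: w1_def linD linN bil b11 b21 b22 P Q algebra_simps)
    then show "mink (N w1) (D w1) = - \<mu>" unfolding 1 by simp
    show "mink (N w1) (D w2) = 0"
      by (simp add: w1_def w2_def linD linN bil b11 b21 b22 P Q algebra_simps)
    have "mink (N w2) (D w2) = \<mu> * ((c * c - s * s) * (c * c - s * s) + 4 * (c * c) * (s * s))"
      by (simp add: w2_def linD linN bil b11 b21 b22 P Q algebra_simps)
    then show "mink (N w2) (D w2) = \<mu>" unfolding 1 by simp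
  qed
  have bw21: "mink (N w2) (D w1) = 0" using sym[of w2 w1] bw by simp
  have gw21: "mink (D w2) (D w1) = 0" using gw by (simp add: mink_commute)
  have herm: "hermitian (X + r *\<^sub>R Y)" if "hermitian X" "hermitian Y" for X Y r
    using that by (auto simp: hermitian_iff)
  have zero: "X = 0" if "hermitian X" "mink p X = 0" "mink n X = 0" "mink (D w1) X = 0" "mink (D w2) X = 0" for X
    by (rule orthogonal_to_frame_imp_zero[OF p n(1) D(1)[of w1] D(1)[of w2] that(1)])
      (use that n D gw in auto)
  have bw': "mink (D w1) (N w1) = - \<mu>" "mink (D w2) (N w1) = 0" "mink (D w2) (N w2) = \<mu>" "mink (D w1) (N w2) = 0"
    using bw bw21 by (simp_all add: mink_commute)
  have N1: "N w1 + \<mu> *\<^sub>R D w1 = 0"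
    by (rule zero) (simp_all add: herm N D bil bw' gw gw21)
  have N2: "N w2 + (- \<mu>) *\<^sub>R D w2 = 0"
    by (rule zero) (simp_all only: herm N D bil bw' gw gw21, simp_all)
  have span: "\<exists>x y. v = x *\<^sub>R w1 + y *\<^sub>R w2" for v
  proof -
    define x y where "x = mink (D w1) (D v)" and "y = mink (D w2) (D v)"
    have "(D v + (- x) *\<^sub>R D w1) + (- y) *\<^sub>R D w2 = 0"
      by (rule zero) (simp_all only: herm D bil gw gw21 x_def[symmetric] y_def[symmetric], simp_all)
    then have "D v = x *\<^sub>R D w1 + y *\<^sub>R D w2" by (simp add: algebra_simps)
    then have "D v = D (x *\<^sub>R w1 + y *\<^sub>R w2)" by (simp add: linD)
    then show ?thesis using inj by (blast dest: injD)
  qed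
  have N1': "N w1 = - \<mu> *\<^sub>R D w1" using N1 by (simp add: add_eq_0_iff2)
  have N2': "N w2 = \<mu> *\<^sub>R D w2" using N2 by simp
  have "\<mu> \<ge> 0" by (simp add: \<mu>_def)
  from that[OF this gw N1' N2' span] show ?thesis .
qed

section \<open>Metrics of the parallel surfaces\<close>

lemma mink_derivative_of_constant:
  assumes f: "(f has_derivative f') (at z)" and g: "(g has_derivative g') (at z)"
    and U: "open U" "z \<in> U" "\<And>w. w \<in> U \<Longrightarrow> mink (f w) (g w) = c"
  shows "mink (f z) (g' v) + mink (f' v) (g z) = 0"
proof -
  have "((\<lambda>w. mink (f w) (g w)) has_derivative (\<lambda>v. mink (f z) (g' v) + mink (f' v) (g z))) (at z)"
    by (rule bounded_bilinear.FDERIV[OF bounded_bilinear_mink f g])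
  moreover have "((\<lambda>w. mink (f w) (g w)) has_derivative (\<lambda>v. 0)) (at z)"
    by (rule has_derivative_transform_within_open[OF has_derivative_const[of c] U(1,2)]) (simp add: U(3))
  ultimately have "(\<lambda>v. mink (f z) (g' v) + mink (f' v) (g z)) = (\<lambda>v. 0)"
    by (rule has_derivative_unique)
  then show ?thesis by (rule fun_cong)
qed

lemma hermitian_derivative:
  assumes f: "(f has_derivative f') (at z)" and U: "open U" "z \<in> U" "\<And>w. w \<in> U \<Longrightarrow> hermitian (f w)"
  shows "hermitian (f' v)"
proof -
  have "linear adj" by (rule linearI) (simp_all add: adj_def vec_eq_iff)
  then have "bounded_linear adj" by (simp add: linear_conv_bounded_linear)
  from bounded_linear.has_derivative[OF this f]
  have "(f has_derivative (\<lambda>v. adj (f' v))) (at z)"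
    by (rule has_derivative_transform_within_open[OF _ U(1,2)]) (use U(3) in \<open>simp add: hermitian_def\<close>)
  from has_derivative_unique[OF this f] show ?thesis unfolding hermitian_def by metis
qed

text \<open>The point \<open>exp\<^sub>p (r \<nu> p)\<close> in closed form; see \<open>hexp_unit\<close>.\<close>

definition parallel_point :: "(mat2 \<Rightarrow> mat2) \<Rightarrow> real \<Rightarrow> mat2 \<Rightarrow> mat2"
  where "parallel_point \<nu> r p = cosh r *\<^sub>R p + sinh r *\<^sub>R \<nu> p"

locale minimal_surface_in_quotient = kleinian_group +
  fixes S :: "mat2 set set" and \<nu> :: "mat2 \<Rightarrow> mat2"
  assumes surface: "closed_embedded_surface \<Gamma> S"
    and normal: "unit_normal_field \<Gamma> S \<nu>"
    and minimal: "minimal_surface \<Gamma> S \<nu>"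
begin

abbreviation St :: "mat2 set" where "St \<equiv> preimage_in_H3 \<Gamma> S"

lemma St_H3: "p \<in> St \<Longrightarrow> p \<in> H3"
  by (simp add: preimage_in_H3_def)

lemma normal_at: "p \<in> St \<Longrightarrow> \<nu> p \<in> H3_tangent p \<and> mink (\<nu> p) (\<nu> p) = 1"
  using normal by (simp add: unit_normal_field_def Let_def)

lemma local_param_normal:
  assumes "local_param St V Y"
  shows "smooth_map_on V (\<nu> \<circ> Y)"
    and "z \<in> V \<Longrightarrow> mink (\<nu> (Y z)) (frechet_derivative Y (at z) w) = 0"
  using normal assms by (simp_all add: unit_normal_field_def Let_def)

lemma local_param_in_St: "local_param St V Y \<Longrightarrow> w \<in> V \<Longrightarrow> Y w \<in> St"
  using openin_imp_subset by (fastforce simp: local_param_def)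

lemma C1_parallel_point:
  assumes lp: "local_param St V Y"
  shows "Ck_on (Suc 0) (parallel_point \<nu> r \<circ> Y) V"
    and "z \<in> V \<Longrightarrow> frechet_derivative (parallel_point \<nu> r \<circ> Y) (at z) v
      = cosh r *\<^sub>R frechet_derivative Y (at z) v + sinh r *\<^sub>R frechet_derivative (\<nu> \<circ> Y) (at z) v"
proof -
  have Y: "Ck_on (Suc 0) Y V" and N: "Ck_on (Suc 0) (\<nu> \<circ> Y) V"
    using lp local_param_normal(1)[OF lp] by (simp_all only: local_param_def smooth_map_on_def)
  have D: "((parallel_point \<nu> r \<circ> Y) has_derivative
      (\<lambda>v. cosh r *\<^sub>R frechet_derivative Y (at z) v + sinh r *\<^sub>R frechet_derivative (\<nu> \<circ> Y) (at z) v)) (at z)"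
    if "z \<in> V" for z
  proof -
    have "parallel_point \<nu> r \<circ> Y = (\<lambda>w. cosh r *\<^sub>R Y w + sinh r *\<^sub>R (\<nu> \<circ> Y) w)"
      by (simp add: fun_eq_iff parallel_point_def)
    then show ?thesis
      using C1_on_has_derivative[OF Y that] C1_on_has_derivative[OF N that]
      by (simp only:) (intro has_derivative_add has_derivative_scaleR_right)
  qed
  have E: "frechet_derivative (parallel_point \<nu> r \<circ> Y) (at z) v
      = cosh r *\<^sub>R frechet_derivative Y (at z) v + sinh r *\<^sub>R frechet_derivative (\<nu> \<circ> Y) (at z) v"
    if "z \<in> V" for z v
    using fun_cong[OF frechet_derivative_at[OF D[OF that]], of v] by simp
  then show "z \<in> V \<Longrightarrow> frechet_derivative (parallel_point \<nu> r \<circ> Y) (at z) v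
      = cosh r *\<^sub>R frechet_derivative Y (at z) v + sinh r *\<^sub>R frechet_derivative (\<nu> \<circ> Y) (at z) v" .
  have "(parallel_point \<nu> r \<circ> Y) differentiable at z" if "z \<in> V" for z
    using D[OF that] by (auto simp: differentiable_def)
  moreover have "continuous_on V (\<lambda>z. frechet_derivative (parallel_point \<nu> r \<circ> Y) (at z) v)" for v
    using Y N by (auto simp: E intro!: continuous_intros cong: continuous_on_cong)
  ultimately show "Ck_on (Suc 0) (parallel_point \<nu> r \<circ> Y) V" by simp
qed

text \<open>Differentiation of \<open>mink (\<nu> \<circ> Y) (dY w) = 0\<close> expresses the second form through the second
  derivative of \<open>Y\<close>, which is symmetric.\<close>

lemma second_form_symmetric:
  assumes lp: "local_param St V Y" and z: "z \<in> V"
  shows "mink (frechet_derivative (\<nu> \<circ> Y) (at z) v) (frechet_derivative Y (at z) w)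
    = mink (frechet_derivative (\<nu> \<circ> Y) (at z) w) (frechet_derivative Y (at z) v)"
proof -
  let ?D = "\<lambda>x. frechet_derivative Y (at x)" and ?N = "frechet_derivative (\<nu> \<circ> Y) (at z)"
  have V: "open V" and Y: "Ck_on (Suc (Suc 0)) Y V" "Ck_on (Suc 0) Y V" and N: "Ck_on (Suc 0) (\<nu> \<circ> Y) V"
    using lp local_param_normal(1)[OF lp] by (simp_all only: local_param_def smooth_map_on_def)
  define L where "L u = frechet_derivative (\<lambda>x. ?D x u) (at z)" for u
  have L: "((\<lambda>x. ?D x u) has_derivative L u) (at z)" for u
    unfolding L_def by (rule C1_on_has_derivative[OF _ z]) (use Y(1) in simp)
  have "mink ((\<nu> \<circ> Y) z) (L u v) + mink (?N v) (?D z u) = 0" for u v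
    by (rule mink_derivative_of_constant[OF C1_on_has_derivative[OF N z] L V z])
      (simp add: local_param_normal(2)[OF lp])
  from this[of w v] this[of v w]
    second_derivative_symmetric[OF V z C1_on_has_derivative[OF Y(2)] L L, of v w]
  show ?thesis by simp
qed

text \<open>The differential of \<open>parallel_point \<nu> r \<circ> Y\<close> is \<open>cosh r dY + sinh r d(\<nu> \<circ> Y)\<close>. In an orthonormal
  basis of principal directions, with \<open>x v\<close> and \<open>y v\<close> the coordinates of \<open>v\<close>, it is diagonal with
  entries \<open>cosh r - \<mu> sinh r\<close> and \<open>cosh r + \<mu> sinh r\<close>. The basis does not depend on \<open>r\<close>, so the
  metrics of all parallel surfaces are diagonal simultaneously.\<close>

lemma parallel_metric:
  assumes lp: "local_param St V Y" and z: "z \<in> V"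
  obtains \<mu> x y where "\<mu> \<ge> 0" "\<mu> \<in> principal_curvatures \<Gamma> S \<nu> (Y z)"
    "\<And>r v. mink (frechet_derivative (parallel_point \<nu> r \<circ> Y) (at z) v)
                (frechet_derivative (parallel_point \<nu> r \<circ> Y) (at z) v)
        = (cosh r)\<^sup>2 * ((1 - \<mu> * tanh r)\<^sup>2 * (x v)\<^sup>2 + (1 + \<mu> * tanh r)\<^sup>2 * (y v)\<^sup>2)"
proof -
  let ?D = "frechet_derivative Y (at z)" and ?N = "frechet_derivative (\<nu> \<circ> Y) (at z)"
  interpret M: bounded_bilinear mink by (rule bounded_bilinear_mink)
  have V: "open V" and Y: "Ck_on (Suc 0) Y V" and N: "Ck_on (Suc 0) (\<nu> \<circ> Y) V"
    and imm: "immersive_at Y z"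
    using lp local_param_normal(1)[OF lp] z by (auto simp only: local_param_def smooth_map_on_def)
  note dY = C1_on_has_derivative[OF Y z] and dN = C1_on_has_derivative[OF N z]
  have pn: "Y w \<in> H3" "hermitian (Y w)" "mink (Y w) (Y w) = -1"
    "hermitian (\<nu> (Y w))" "mink (Y w) (\<nu> (Y w)) = 0" "mink (\<nu> (Y w)) (\<nu> (Y w)) = 1" if "w \<in> V" for w
    using St_H3[OF local_param_in_St[OF lp that]] normal_at[OF local_param_in_St[OF lp that]]
    by (auto simp: H3_iff H3_tangent_def)
  have hD: "hermitian (?D v)" for v
    by (rule hermitian_derivative[OF dY V z]) (simp add: pn)
  have hN: "hermitian (?N v)" for v
    by (rule hermitian_derivative[OF dN V z]) (simp add: pn)
  have pD: "mink (Y z) (?D v) = 0" for v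
    using mink_derivative_of_constant[OF dY dY V z pn(3), of v] by (simp add: mink_commute)
  have nD: "mink (\<nu> (Y z)) (?D v) = 0" for v
    by (rule local_param_normal(2)[OF lp z])
  have "mink ((\<nu> \<circ> Y) w) ((\<nu> \<circ> Y) w) = 1" if "w \<in> V" for w using pn(6)[OF that] by simp
  from mink_derivative_of_constant[OF dN dN V z this] have nN: "mink (\<nu> (Y z)) (?N v) = 0" for v
    by (simp add: mink_commute)
  have "mink (Y w) ((\<nu> \<circ> Y) w) = 0" if "w \<in> V" for w using pn(5)[OF that] by simp
  from mink_derivative_of_constant[OF dY dN V z this] nD have pN: "mink (Y z) (?N v) = 0" for v
    by (simp add: mink_commute)
  have linD: "linear ?D" and linN: "linear ?N" using dY dN has_derivative_linear by auto
  note lin = linear_add[OF linD] linear_scale[OF linD] linear_add[OF linN] linear_scale[OF linN]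
  note bil = M.add_left M.add_right M.scaleR_left M.scaleR_right
  have inj: "inj ?D" using imm by (simp add: immersive_at_def)
  (* The denominator of the mean curvature is positive, so minimality makes its numerator vanish. *)
  have "mink (?D 1) (?D 1) * mink (?D \<i>) (?D \<i>) - (mink (?D 1) (?D \<i>))\<^sup>2 > 0"
    (is "?A * ?C - ?B\<^sup>2 > 0")
  proof -
    have pos: "mink (?D v) (?D v) > 0" if "v \<noteq> 0" for v
    proof -
      have "?D v \<noteq> 0" using inj linear_0[OF linD] that by (metis injD)
      then show ?thesis using mink_positive_definite[OF pn(1)[OF z] hD pD] by blast
    qed
    have A: "?A > 0" by (rule pos) simp
    have nz: "?A *\<^sub>R \<i> + (- ?B) *\<^sub>R 1 \<noteq> 0" using A by (simp add: complex_eq_iff)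
    have "mink (?D \<i>) (?D 1) = ?B" by (rule mink_commute)
    then have "mink (?D (?A *\<^sub>R \<i> + (- ?B) *\<^sub>R 1)) (?D (?A *\<^sub>R \<i> + (- ?B) *\<^sub>R 1)) = ?A * (?A * ?C - ?B\<^sup>2)"
      unfolding lin bil by (simp add: power2_eq_square algebra_simps)
    then show ?thesis using pos[OF nz] A by (simp add: zero_less_mult_iff)
  qed
  moreover have "mean_curvature_at \<nu> Y z = 0" using minimal lp z by (auto simp: minimal_surface_def)
  ultimately have tr: "mink (?N 1) (?D 1) * mink (?D \<i>) (?D \<i>) - 2 * mink (?N 1) (?D \<i>) * mink (?D 1) (?D \<i>)
      + mink (?N \<i>) (?D \<i>) * mink (?D 1) (?D 1) = 0"
    by (simp add: mean_curvature_at_def Let_def)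
  obtain \<mu> w1 w2 where \<mu>: "\<mu> \<ge> 0" and g: "mink (?D w1) (?D w1) = 1" "mink (?D w1) (?D w2) = 0" "mink (?D w2) (?D w2) = 1"
    and n: "?N w1 = - \<mu> *\<^sub>R ?D w1" "?N w2 = \<mu> *\<^sub>R ?D w2" and span: "\<And>v. \<exists>x y. v = x *\<^sub>R w1 + y *\<^sub>R w2"
    by (rule shape_operator_diagonalization[OF pn(1)[OF z] pn(4)[OF z] pn(5)[OF z] pn(6)[OF z] linD linN inj hD pD nD hN pN nN
          second_form_symmetric[OF lp z] tr]) blast
  obtain x y where xy: "\<And>v. v = x v *\<^sub>R w1 + y v *\<^sub>R w2" using span by metis
  have "w1 \<noteq> 0" using g(1) linear_0[OF linD] by (auto simp: M.zero_left)
  then have "\<mu> \<in> principal_curvatures \<Gamma> S \<nu> (Y z)"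
    unfolding principal_curvatures_def using lp z n(1) by (intro CollectI exI[of _ V] exI[of _ Y] exI[of _ z] exI[of _ w1]) simp
  moreover have "mink (frechet_derivative (parallel_point \<nu> r \<circ> Y) (at z) v)
                (frechet_derivative (parallel_point \<nu> r \<circ> Y) (at z) v)
        = (cosh r)\<^sup>2 * ((1 - \<mu> * tanh r)\<^sup>2 * (x v)\<^sup>2 + (1 + \<mu> * tanh r)\<^sup>2 * (y v)\<^sup>2)" for r v
  proof -
    have sinh: "sinh r = cosh r * tanh r" by (simp add: tanh_def)
    have Dv: "?D v = x v *\<^sub>R ?D w1 + y v *\<^sub>R ?D w2" and Nv: "?N v = x v *\<^sub>R ?N w1 + y v *\<^sub>R ?N w2"
      using arg_cong[OF xy[of v], of ?D] arg_cong[OF xy[of v], of ?N] by (simp_all only: lin)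
    have "frechet_derivative (parallel_point \<nu> r \<circ> Y) (at z) v
      = (cosh r * (1 - \<mu> * tanh r) * x v) *\<^sub>R ?D w1 + (cosh r * (1 + \<mu> * tanh r) * y v) *\<^sub>R ?D w2"
      unfolding C1_parallel_point(2)[OF lp z] Dv Nv n sinh by (simp add: algebra_simps)
    moreover have "mink (?D w2) (?D w1) = 0" using g(2) by (simp add: mink_commute)
    ultimately show ?thesis
      by (simp add: bil g) (simp add: power2_eq_square algebra_simps)
  qed
  ultimately show ?thesis using that[OF \<mu>] by blast
qed

end

section \<open>Lifts of maps to the quotient\<close>

lemma continuous_map_orbit: "continuous_map (top_of_set H3) (hyp_quotient \<Gamma>) (orbit_of \<Gamma>)"
  by (auto simp: continuous_map_def topspace_hyp_quotient openin_hyp_quotient)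

text \<open>If \<open>f z \<noteq> g z\<close>, then \<open>f\<close> and \<open>g\<close> differ on a closed ball around \<open>z\<close>; by Baire, one of the
  countably many closed sets that cover the ball has an interior point there.\<close>

lemma eq_on_open_if_eq_on_interiors:
  fixes f g :: "'a::euclidean_space \<Rightarrow> 'b::real_normed_vector"
  assumes U: "open U" and cont: "continuous_on U f" "continuous_on U g" and I: "countable I"
    and cover: "\<And>x. x \<in> U \<Longrightarrow> \<exists>i\<in>I. x \<in> E i"
    and closed: "\<And>i. i \<in> I \<Longrightarrow> closedin (top_of_set U) (E i)"
    and eq: "\<And>i x. i \<in> I \<Longrightarrow> x \<in> interior (E i) \<Longrightarrow> f x = g x"
    and z: "z \<in> U"
  shows "f z = g z"
proof (rule ccontr)
  assume ne: "f z \<noteq> g z"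
  define W where "W = {x \<in> U. f x - g x \<noteq> 0}"
  have W: "open W"
  proof -
    have "open (U \<inter> (\<lambda>x. f x - g x) -` (- {0}))"
      using cont U by (intro continuous_open_preimage continuous_intros) auto
    moreover have "U \<inter> (\<lambda>x. f x - g x) -` (- {0}) = W" by (auto simp: W_def)
    ultimately show ?thesis by simp
  qed
  moreover have "z \<in> W" using ne z by (simp add: W_def)
  ultimately obtain e where e: "e > 0" "cball z e \<subseteq> W" using open_contains_cball by blast
  let ?B = "cball z e"
  have BU: "?B \<subseteq> U" using e by (auto simp: W_def)
  let ?G = "(\<lambda>i. ?B \<inter> E i) ` I"
  have "top_of_set ?B interior_of \<Union>?G = {}"
  proof (rule Baire_category_alt)
    show "completely_metrizable_space (top_of_set ?B) \<or>
        locally_compact_space (top_of_set ?B) \<and> regular_space (top_of_set ?B)"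
      by (simp add: completely_metrizable_space_euclidean completely_metrizable_space_closedin)
    show "countable ?G" using I by simp
    fix T assume "T \<in> ?G"
    then obtain i where i: "i \<in> I" "T = ?B \<inter> E i" by blast
    obtain C where C: "closed C" "E i = U \<inter> C" using closed[OF i(1)] unfolding closedin_closed by blast
    then have "T = ?B \<inter> C" using BU i(2) by blast
    then have "closedin (top_of_set ?B) T" using closedin_closed_Int[OF C(1)] by simp
    moreover have "top_of_set ?B interior_of T = {}"
    proof (rule ccontr)
      assume "top_of_set ?B interior_of T \<noteq> {}"
      then obtain y T' where T': "openin (top_of_set ?B) T'" "y \<in> T'" "T' \<subseteq> T"
        unfolding interior_of_def by blast
      from T'(1) obtain O' where O': "open O'" "T' = ?B \<inter> O'" unfolding openin_open by blast
      then have "O' \<inter> ?B \<noteq> {}" using T'(2) by blast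
      then have "O' \<inter> closure (ball z e) \<noteq> {}" using e(1) by simp
      then have "O' \<inter> ball z e \<noteq> {}" using open_Int_closure_eq_empty[OF O'(1)] by blast
      then obtain x where x: "x \<in> O' \<inter> ball z e" by blast
      have "O' \<inter> ball z e \<subseteq> E i" using O'(2) T'(3) ball_subset_cball[of z e] i(2) by blast
      then have "x \<in> interior (E i)" using x O'(1) by (meson interior_maximal open_Int open_ball subsetD)
      then have "f x = g x" by (rule eq[OF i(1)])
      moreover have "x \<in> W" using x e(2) ball_subset_cball by blast
      ultimately show False by (simp add: W_def)
    qed
    ultimately show "closedin (top_of_set ?B) T \<and> top_of_set ?B interior_of T = {}" by blast
  qed
  moreover have "\<Union>?G = ?B" using cover BU by blast
  ultimately have "?B = {}" using interior_of_topspace[of "top_of_set ?B"] by simp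
  then show False using e(1) by simp
qed

context kleinian_group
begin

text \<open>The element \<open>\<gamma>\<close> of the group with \<open>Y = \<gamma> \<circ> Z\<close> may depend on the point, but the group is countable,
  so it is constant on the interiors of countably many closed sets that cover the domain. There the
  metrics agree because \<open>\<gamma>\<close> is a linear isometry, and both metrics are continuous.\<close>

lemma lifts_isometric:
  fixes Y Z :: "'a::euclidean_space \<Rightarrow> mat2"
  assumes U: "open U" and Y: "Ck_on (Suc 0) Y U" and Z: "Ck_on (Suc 0) Z U"
    and orbit: "\<And>w. w \<in> U \<Longrightarrow> orbit_of \<Gamma> (Y w) = orbit_of \<Gamma> (Z w)" and z: "z \<in> U"
  shows "mink (frechet_derivative Y (at z) u) (frechet_derivative Y (at z) v)
       = mink (frechet_derivative Z (at z) u) (frechet_derivative Z (at z) v)"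
proof -
  define E where "E \<gamma> = {w \<in> U. Y w - \<gamma> (Z w) = 0}" for \<gamma>
  interpret M: bounded_bilinear mink by (rule bounded_bilinear_mink)
  have cont: "continuous_on U (\<lambda>z. mink (frechet_derivative F (at z) u) (frechet_derivative F (at z) v))"
    if "Ck_on (Suc 0) F U" for F
    using that by (intro M.continuous_on) auto
  show ?thesis
  proof (rule eq_on_open_if_eq_on_interiors[where E = E and I = \<Gamma>, OF U cont[OF Y] cont[OF Z] countable_group _ _ _ z])
    fix w assume w: "w \<in> U"
    then have "Y w \<in> orbit_of \<Gamma> (Z w)" using orbit[OF w] orbit_refl[of "Y w"] by simp
    then show "\<exists>\<gamma>\<in>\<Gamma>. w \<in> E \<gamma>" using w by (auto simp: orbit_of_def E_def)
  next
    fix \<gamma> assume "\<gamma> \<in> \<Gamma>"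
    then have lin: "bounded_linear \<gamma>" by (rule group_element_bounded_linear)
    have "continuous_on U (\<lambda>w. Y w - \<gamma> (Z w))"
      by (intro continuous_on_diff C1_on_continuous[OF Y] bounded_linear.continuous_on[OF lin] C1_on_continuous[OF Z])
    from continuous_closedin_preimage[OF this closed_singleton[of 0]]
    show "closedin (top_of_set U) (E \<gamma>)" by (simp add: E_def vimage_def Int_def)
    fix w assume w: "w \<in> interior (E \<gamma>)"
    then have wU: "w \<in> U" using interior_subset by (auto simp: E_def)
    note dZ = C1_on_has_derivative[OF Z wU]
    have "((\<lambda>x. \<gamma> (Z x)) has_derivative (\<lambda>v. \<gamma> (frechet_derivative Z (at w) v))) (at w)"
      by (rule bounded_linear.has_derivative[OF lin dZ])
    then have "(Y has_derivative (\<lambda>v. \<gamma> (frechet_derivative Z (at w) v))) (at w)"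
      by (rule has_derivative_transform_within_open[OF _ open_interior w])
        (use interior_subset in \<open>force simp: E_def\<close>)
    then have "frechet_derivative Y (at w) = (\<lambda>v. \<gamma> (frechet_derivative Z (at w) v))"
      by (metis frechet_derivative_at)
    then show "mink (frechet_derivative Y (at w) u) (frechet_derivative Y (at w) v)
       = mink (frechet_derivative Z (at w) u) (frechet_derivative Z (at w) v)"
      using group_element_mink[OF \<open>\<gamma> \<in> \<Gamma>\<close>] by simp
  qed
qed

end

context minimal_surface_in_quotient
begin

lemma group_element_St: "\<gamma> \<in> \<Gamma> \<Longrightarrow> p \<in> St \<Longrightarrow> \<gamma> p \<in> St"
  using group_element_H3 orbit_group_element by (simp add: preimage_in_H3_def)

text \<open>The group acts by linear maps, and \<open>\<nu>\<close> is equivariant.\<close>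

lemma parallel_map_orbit:
  assumes p: "p \<in> St"
  shows "parallel_map \<nu> r (orbit_of \<Gamma> p) = orbit_of \<Gamma> (parallel_point \<nu> r p)"
proof -
  have "hexp (\<gamma> p) (r *\<^sub>R \<nu> (\<gamma> p)) = \<gamma> (parallel_point \<nu> r p)" if \<gamma>: "\<gamma> \<in> \<Gamma>" for \<gamma>
  proof -
    have q: "\<gamma> p \<in> St" by (rule group_element_St[OF \<gamma> p])
    have 1: "hexp (\<gamma> p) (r *\<^sub>R \<nu> (\<gamma> p)) = cosh r *\<^sub>R \<gamma> p + sinh r *\<^sub>R \<nu> (\<gamma> p)"
      using normal_at[OF q] by (intro hexp_unit St_H3[OF q]) auto
    have 2: "\<nu> (\<gamma> p) = \<gamma> (\<nu> p)"
      using normal p \<gamma> by (simp add: unit_normal_field_def Let_def)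
    have lin: "linear \<gamma>" by (rule bounded_linear.linear[OF group_element_bounded_linear[OF \<gamma>]])
    show ?thesis
      unfolding 1 unfolding 2 parallel_point_def by (simp add: linear_add[OF lin] linear_scale[OF lin])
  qed
  then show ?thesis by (auto simp: parallel_map_def orbit_of_def image_image)
qed

text \<open>The set \<open>St\<close> is a topological surface, so the injective continuous map \<open>Y\<close> from a plane domain is
  open by invariance of domain. Thus the lifts through which the marking is given are among
  the local parametrizations on which the normal field and the curvatures are controlled.\<close>

lemma local_param_of_injective_immersion:
  assumes V: "open V" and Y: "smooth_map_on V Y" "Y ` V \<subseteq> St" "\<And>w. w \<in> V \<Longrightarrow> immersive_at Y w"
    and k: "continuous_on (Y ` V) k" "\<And>w. w \<in> V \<Longrightarrow> k (Y w) = w"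
  shows "local_param St V Y"
proof -
  have cY: "continuous_on V Y" by (rule C1_on_continuous[OF smooth_map_on_imp_C1[OF Y(1)]])
  have inj: "inj_on Y V" using k(2) by (metis inj_onI)
  have "k ` Y ` V = V" using k(2) by force
  then have hom: "homeomorphism V (Y ` V) Y k"
    using cY k by (auto simp: homeomorphism_def)
  have "\<exists>T. openin (top_of_set St) T \<and> p \<in> T \<and> T \<subseteq> Y ` V" if "p \<in> Y ` V" for p
  proof -
    have "p \<in> St" using that Y(2) by blast
    then obtain V1 X1 where lp: "local_param St V1 X1" "p \<in> X1 ` V1"
      using surface unfolding closed_embedded_surface_def embedded_surface_def by meson
    then obtain Y1 where V1: "open V1" "openin (top_of_set St) (X1 ` V1)" and hom1: "homeomorphism V1 (X1 ` V1) X1 Y1"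
      by (auto simp: local_param_def)
    define V' where "V' = {w \<in> V. Y w \<in> X1 ` V1}"
    have "openin (top_of_set V) (V \<inter> Y -` (X1 ` V1))"
      by (rule continuous_openin_preimage[OF cY _ V1(2)]) (use Y(2) in auto)
    moreover have "V \<inter> Y -` (X1 ` V1) = V'" unfolding V'_def by blast
    ultimately have V': "open V'" using V openin_open_trans by metis
    have YV': "Y ` V' \<subseteq> X1 ` V1" and sub': "V' \<subseteq> V" unfolding V'_def by blast+
    have cont: "continuous_on V' (Y1 \<circ> Y)"
      by (rule continuous_on_compose[OF continuous_on_subset[OF cY sub'] continuous_on_subset[OF homeomorphism_cont2[OF hom1] YV']])
    have "inj_on Y1 (Y ` V')"
      by (rule inj_on_subset[OF inj_on_inverseI[of "X1 ` V1" X1] YV']) (rule homeomorphism_apply2[OF hom1])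
    then have "inj_on (Y1 \<circ> Y) V'" by (rule comp_inj_on[OF inj_on_subset[OF inj sub']])
    then have op: "open ((Y1 \<circ> Y) ` V')" by (rule invariance_of_domain[OF cont V'])
    have sub: "(Y1 \<circ> Y) ` V' \<subseteq> V1" using YV' homeomorphism_image2[OF hom1] unfolding image_comp[symmetric] by blast
    have "openin (top_of_set (X1 ` V1)) (X1 ` (Y1 \<circ> Y) ` V')"
      by (rule homeomorphism_imp_open_map[OF hom1]) (use op sub V1(1) in \<open>simp add: openin_open_eq\<close>)
    moreover have "X1 ` (Y1 \<circ> Y) ` V' = Y ` V'"
    proof -
      have "X1 (Y1 (Y w)) = Y w" if "w \<in> V'" for w
        using homeomorphism_apply2[OF hom1] YV' that by blast
      then show ?thesis unfolding image_image o_def by (intro image_cong) auto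
    qed
    ultimately have "openin (top_of_set St) (Y ` V')" using openin_trans[OF _ V1(2)] by metis
    moreover have "p \<in> Y ` V'" using that lp(2) unfolding V'_def by blast
    moreover have "Y ` V' \<subseteq> Y ` V" using sub' by blast
    ultimately show ?thesis by blast
  qed
  then have "openin (top_of_set St) (Y ` V)" using openin_subopen by blast
  then show ?thesis using assms hom by (auto simp: local_param_def)
qed

end

section \<open>Charts of the surface\<close>

lemma is_chartD:
  assumes "is_chart X (U, \<phi>)"
  shows chart_subset: "U \<subseteq> topspace X" and chart_inj: "inj_on \<phi> U"
    and chart_open_image: "openin X V \<Longrightarrow> open (\<phi> ` (U \<inter> V))"
    and chart_continuous: "continuous_map (subtopology X U) (top_of_set (\<phi> ` U)) \<phi>"
proof -
  have U: "openin X U" "open (\<phi> ` U)" and hom: "homeomorphic_map (subtopology X U) (top_of_set (\<phi> ` U)) \<phi>"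
    using assms by (auto simp: is_chart_def)
  show sub: "U \<subseteq> topspace X" using U(1) by (rule openin_subset)
  then show "inj_on \<phi> U"
    using homeomorphic_imp_injective_map[OF hom] by (simp add: Int_absorb1)
  show "continuous_map (subtopology X U) (top_of_set (\<phi> ` U)) \<phi>"
    by (rule homeomorphic_imp_continuous_map[OF hom])
  show "open (\<phi> ` (U \<inter> V))" if V: "openin X V"
  proof -
    have "openin (subtopology X U) (U \<inter> V)" using V by (rule openin_subtopology_Int2)
    then have "openin (top_of_set (\<phi> ` U)) (\<phi> ` (U \<inter> V))"
      using homeomorphic_imp_open_map[OF hom] by (simp add: open_map_def)
    then show ?thesis using U(2) by (rule openin_open_trans)
  qed
qed

definition compatible_chart :: "'a topology \<Rightarrow> 'a chart set \<Rightarrow> 'a set \<Rightarrow> ('a \<Rightarrow> complex) \<Rightarrow> bool"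
  where "compatible_chart X A U \<phi> \<longleftrightarrow> oriented_smooth_atlas X (insert (U, \<phi>) A)"

lemma compatible_chartD:
  assumes "compatible_chart X A U \<phi>"
  shows compatible_is_chart: "is_chart X (U, \<phi>)"
    and "(W, \<alpha>) \<in> A \<Longrightarrow> is_chart X (W, \<alpha>)"
    and "(W, \<alpha>) \<in> A \<Longrightarrow> Ck_on (Suc 0) (\<alpha> \<circ> inv_into U \<phi>) (\<phi> ` (U \<inter> W))"
    and "(W, \<alpha>) \<in> A \<Longrightarrow> Ck_on (Suc 0) (\<phi> \<circ> inv_into W \<alpha>) (\<alpha> ` (W \<inter> U))"
    and "(W, \<alpha>) \<in> A \<Longrightarrow> z \<in> \<phi> ` (U \<inter> W) \<Longrightarrow>
      Im (cnj (frechet_derivative (\<alpha> \<circ> inv_into U \<phi>) (at z) 1) * frechet_derivative (\<alpha> \<circ> inv_into U \<phi>) (at z) \<i>) > 0"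
    and "(W, \<alpha>) \<in> A \<Longrightarrow> z \<in> \<alpha> ` (W \<inter> U) \<Longrightarrow>
      Im (cnj (frechet_derivative (\<phi> \<circ> inv_into W \<alpha>) (at z) 1) * frechet_derivative (\<phi> \<circ> inv_into W \<alpha>) (at z) \<i>) > 0"
  using assms unfolding compatible_chart_def oriented_smooth_atlas_def
  by (auto simp: Let_def smooth_map_on_def simp del: Ck_on.simps)

lemma orientation_compose:
  fixes R T :: "complex \<Rightarrow> complex"
  assumes "linear R"
  shows "Im (cnj (R (T 1)) * R (T \<i>)) = Im (cnj (R 1) * R \<i>) * Im (cnj (T 1) * T \<i>)"
proof -
  have R: "R w = Re w *\<^sub>R R 1 + Im w *\<^sub>R R \<i>" for w
  proof -
    have "w = Re w *\<^sub>R 1 + Im w *\<^sub>R \<i>" by (simp add: complex_eq_iff)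
    then have "R w = R (Re w *\<^sub>R 1 + Im w *\<^sub>R \<i>)" by simp
    then show ?thesis by (simp add: linear_add[OF assms] linear_scale[OF assms])
  qed
  show ?thesis unfolding R[of "T 1"] R[of "T \<i>"] by (simp add: algebra_simps)
qed

text \<open>The charts \<open>\<phi>\<close> and \<open>\<psi>\<close> belong to different conformal structures and are compatible only with the
  atlas \<open>A\<close>, so their transition map is studied by passing through a chart \<open>\<alpha>\<close> of \<open>A\<close>.\<close>

lemma transition_factorization:
  assumes \<phi>: "compatible_chart X A U \<phi>" and \<psi>: "compatible_chart X A V \<psi>" and \<alpha>: "(W, \<alpha>) \<in> A"
    and x: "x \<in> U" "x \<in> V" "x \<in> W"
  shows "\<exists>N. open N \<and> \<phi> x \<in> N \<and> Ck_on (Suc 0) (\<psi> \<circ> inv_into U \<phi>) N"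
    and "Im (cnj (frechet_derivative (\<psi> \<circ> inv_into U \<phi>) (at (\<phi> x)) 1)
          * frechet_derivative (\<psi> \<circ> inv_into U \<phi>) (at (\<phi> x)) \<i>) > 0"
    and "frechet_derivative (\<alpha> \<circ> inv_into V \<psi>) (at (\<psi> x)) (frechet_derivative (\<psi> \<circ> inv_into U \<phi>) (at (\<phi> x)) v)
       = frechet_derivative (\<alpha> \<circ> inv_into U \<phi>) (at (\<phi> x)) v"
proof -
  note charts = compatible_chartD(1)[OF \<phi>] compatible_chartD(1)[OF \<psi>] compatible_chartD(2)[OF \<phi> \<alpha>]
  have inv: "inv_into U \<phi> (\<phi> y) = y" if "y \<in> U" for y using that chart_inj[OF charts(1)] by simp
  have invV: "inv_into V \<psi> (\<psi> y) = y" if "y \<in> V" for y using that chart_inj[OF charts(2)] by simp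
  have invW: "inv_into W \<alpha> (\<alpha> y) = y" if "y \<in> W" for y using that chart_inj[OF charts(3)] by simp
  define N where "N = \<phi> ` (U \<inter> (V \<inter> W))"
  have "openin X (V \<inter> W)" using charts by (auto simp: is_chart_def)
  then have N: "open N" unfolding N_def by (rule chart_open_image[OF charts(1)])
  have xN: "\<phi> x \<in> N" using x by (auto simp: N_def)
  let ?p = "\<alpha> \<circ> inv_into U \<phi>" and ?q = "\<psi> \<circ> inv_into W \<alpha>" and ?t = "\<psi> \<circ> inv_into U \<phi>" and ?s = "\<alpha> \<circ> inv_into V \<psi>"
  have p: "Ck_on (Suc 0) ?p N"
    by (rule Ck_on_subset[OF compatible_chartD(3)[OF \<phi> \<alpha>]]) (auto simp: N_def)
  have pim: "?p ` N \<subseteq> \<alpha> ` (W \<inter> V)" by (auto simp: N_def inv)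
  have q: "Ck_on (Suc 0) ?q (\<alpha> ` (W \<inter> V))" by (rule compatible_chartD(4)[OF \<psi> \<alpha>])
  have qp: "Ck_on (Suc 0) (?q \<circ> ?p) N" by (rule C1_on_compose[OF p q pim])
  have eq: "(?q \<circ> ?p) z = ?t z" if "z \<in> N" for z using that by (auto simp: N_def inv invW)
  have t: "Ck_on (Suc 0) ?t N" by (rule C1_on_cong(1)[OF qp N eq])
  then show "\<exists>N. open N \<and> \<phi> x \<in> N \<and> Ck_on (Suc 0) ?t N" using N xN by blast
  have px: "?p (\<phi> x) = \<alpha> x" and tx: "?t (\<phi> x) = \<psi> x" using x by (simp_all add: inv)
  have dp: "?p differentiable at (\<phi> x)" by (rule C1_on_differentiable[OF p xN])
  have dq: "?q differentiable at (\<alpha> x)" by (rule C1_on_differentiable[OF q]) (use x in auto)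
  have "frechet_derivative ?t (at (\<phi> x)) = frechet_derivative (?q \<circ> ?p) (at (\<phi> x))"
    by (rule C1_on_cong(2)[OF qp N eq xN])
  then have "frechet_derivative ?t (at (\<phi> x)) v = frechet_derivative ?q (at (\<alpha> x)) (frechet_derivative ?p (at (\<phi> x)) v)" for v
    using frechet_derivative_comp_apply[of ?q ?p "\<phi> x" v] dp dq px by simp
  then have "Im (cnj (frechet_derivative ?t (at (\<phi> x)) 1) * frechet_derivative ?t (at (\<phi> x)) \<i>)
     = Im (cnj (frechet_derivative ?q (at (\<alpha> x)) 1) * frechet_derivative ?q (at (\<alpha> x)) \<i>)
     * Im (cnj (frechet_derivative ?p (at (\<phi> x)) 1) * frechet_derivative ?p (at (\<phi> x)) \<i>)"
    using orientation_compose[OF linear_frechet_derivative[OF dq]] by simp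
  moreover have "Im (cnj (frechet_derivative ?q (at (\<alpha> x)) 1) * frechet_derivative ?q (at (\<alpha> x)) \<i>) > 0"
    by (rule compatible_chartD(6)[OF \<psi> \<alpha>]) (use x in auto)
  moreover have "Im (cnj (frechet_derivative ?p (at (\<phi> x)) 1) * frechet_derivative ?p (at (\<phi> x)) \<i>) > 0"
    by (rule compatible_chartD(5)[OF \<phi> \<alpha>]) (use x in auto)
  ultimately show "Im (cnj (frechet_derivative ?t (at (\<phi> x)) 1) * frechet_derivative ?t (at (\<phi> x)) \<i>) > 0"
    by simp
  have s: "Ck_on (Suc 0) ?s (\<psi> ` (V \<inter> W))" by (rule compatible_chartD(3)[OF \<psi> \<alpha>])
  have tim: "?t ` N \<subseteq> \<psi> ` (V \<inter> W)" by (auto simp: N_def inv)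
  have st: "Ck_on (Suc 0) (?s \<circ> ?t) N" by (rule C1_on_compose[OF t s tim])
  have eq': "(?s \<circ> ?t) z = ?p z" if "z \<in> N" for z using that by (auto simp: N_def inv invV)
  have ds: "?s differentiable at (\<psi> x)" by (rule C1_on_differentiable[OF s]) (use x in auto)
  have "frechet_derivative ?p (at (\<phi> x)) = frechet_derivative (?s \<circ> ?t) (at (\<phi> x))"
    by (rule C1_on_cong(2)[OF st N eq' xN])
  then show "frechet_derivative ?s (at (\<psi> x)) (frechet_derivative ?t (at (\<phi> x)) v) = frechet_derivative ?p (at (\<phi> x)) v"
    using frechet_derivative_comp_apply[of ?s ?t "\<phi> x" v] ds C1_on_differentiable[OF t xN] tx by simp
qed

lemma C1_transition:
  assumes \<phi>: "compatible_chart X A U \<phi>" and \<psi>: "compatible_chart X A V \<psi>" and cover: "\<Union> (fst ` A) = topspace X"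
  shows "Ck_on (Suc 0) (\<psi> \<circ> inv_into U \<phi>) (\<phi> ` (U \<inter> V))"
proof (rule C1_on_locally)
  fix z assume "z \<in> \<phi> ` (U \<inter> V)"
  then obtain x where x: "z = \<phi> x" "x \<in> U" "x \<in> V" by blast
  then have "x \<in> \<Union> (fst ` A)" using cover chart_subset[OF compatible_chartD(1)[OF \<phi>]] by blast
  then obtain W \<alpha> where "(W, \<alpha>) \<in> A" "x \<in> W" by auto
  from transition_factorization(1)[OF \<phi> \<psi> this(1) x(2,3) this(2)] x(1)
  show "\<exists>N. open N \<and> z \<in> N \<and> Ck_on (Suc 0) (\<psi> \<circ> inv_into U \<phi>) N" by simp
qed

lemma homeomorphism_transition:
  assumes \<phi>: "compatible_chart X A U \<phi>" and \<psi>: "compatible_chart X A V \<psi>" and cover: "\<Union> (fst ` A) = topspace X"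
  shows "homeomorphism (\<phi> ` (U \<inter> V)) ((\<psi> \<circ> inv_into U \<phi>) ` \<phi> ` (U \<inter> V)) (\<psi> \<circ> inv_into U \<phi>) (\<phi> \<circ> inv_into V \<psi>)"
proof -
  have inv: "inv_into U \<phi> (\<phi> y) = y" if "y \<in> U" for y
    using that chart_inj[OF compatible_chartD(1)[OF \<phi>]] by simp
  have invV: "inv_into V \<psi> (\<psi> y) = y" if "y \<in> V" for y
    using that chart_inj[OF compatible_chartD(1)[OF \<psi>]] by simp
  have im: "(\<psi> \<circ> inv_into U \<phi>) ` \<phi> ` (U \<inter> V) = \<psi> ` (U \<inter> V)"
    unfolding image_image by (intro image_cong) (auto simp: inv)
  have im': "(\<phi> \<circ> inv_into V \<psi>) ` \<psi> ` (U \<inter> V) = \<phi> ` (U \<inter> V)"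
    unfolding image_image by (intro image_cong) (auto simp: invV)
  have "continuous_on (\<psi> ` (U \<inter> V)) (\<phi> \<circ> inv_into V \<psi>)"
    using C1_on_continuous[OF C1_transition[OF \<psi> \<phi> cover]] by (simp add: Int_commute)
  then show ?thesis
    unfolding homeomorphism_def im im'
    using C1_on_continuous[OF C1_transition[OF \<phi> \<psi> cover]] by (auto simp: inv invV)
qed

section \<open>The numerical estimate\<close>

text \<open>With \<open>L x = ln ((1 + x) / (1 - x))\<close> this is \<open>L (\<mu> t) - L (\<mu> s) \<le> \<bar>L (l t) - L (l s)\<bar>\<close> without the
  logarithms on the left. For \<open>s \<le> t\<close> it amounts to \<open>(t - s) (l - \<mu>) (1 + \<mu> t l s) \<ge> 0\<close>, and for
  \<open>s > t\<close> the left-hand difference is not positive.\<close>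

lemma dilatation_exponent_mono:
  fixes \<mu> l s t :: real
  assumes "0 \<le> \<mu>" "\<mu> \<le> l" "l \<le> 1" "\<bar>s\<bar> < 1" "\<bar>t\<bar> < 1"
  shows "(1 + \<mu> * t) * (1 - \<mu> * s)
    \<le> exp \<bar>ln ((1 + l * t) / (1 - l * t)) - ln ((1 + l * s) / (1 - l * s))\<bar> * ((1 - \<mu> * t) * (1 + \<mu> * s))"
proof -
  define K where "K = exp \<bar>ln ((1 + l * t) / (1 - l * t)) - ln ((1 + l * s) / (1 - l * s))\<bar>"
  have small: "\<bar>m * r\<bar> < 1" if "0 \<le> m" "m \<le> 1" "\<bar>r\<bar> < 1" for m r :: real
    using mult_left_le_one_le[of "\<bar>r\<bar>" m] that by (simp add: abs_mult)
  have l: "\<bar>l * t\<bar> < 1" "\<bar>l * s\<bar> < 1" and m: "\<bar>\<mu> * t\<bar> < 1" "\<bar>\<mu> * s\<bar> < 1"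
    using assms by (auto intro!: small)
  have pos: "(1 - \<mu> * t) * (1 + \<mu> * s) > 0" using m by (intro mult_pos_pos) auto
  have "(1 + \<mu> * t) * (1 - \<mu> * s) \<le> K * ((1 - \<mu> * t) * (1 + \<mu> * s))"
  proof (cases "s \<le> t")
    case True
    have d: "(1 - l * t) * (1 + l * s) > 0" using l by (intro mult_pos_pos) auto
    have "(t - s) * ((l - \<mu>) * (1 + (\<mu> * t) * (l * s))) \<ge> 0"
    proof -
      have "\<bar>(\<mu> * t) * (l * s)\<bar> < 1"
        using abs_mult_less[OF m(1) l(2)] by (simp add: abs_mult)
      then show ?thesis using True assms(2) by (intro mult_nonneg_nonneg) auto
    qed
    then have "(1 + \<mu> * t) * (1 - \<mu> * s) * ((1 - l * t) * (1 + l * s))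
      \<le> (1 + l * t) * (1 - l * s) * ((1 - \<mu> * t) * (1 + \<mu> * s))"
      by (simp add: algebra_simps)
    then have "(1 + \<mu> * t) * (1 - \<mu> * s)
      \<le> ((1 + l * t) * (1 - l * s)) / ((1 - l * t) * (1 + l * s)) * ((1 - \<mu> * t) * (1 + \<mu> * s))"
      using d by (simp add: pos_le_divide_eq)
    moreover have "((1 + l * t) * (1 - l * s)) / ((1 - l * t) * (1 + l * s)) \<le> K"
    proof -
      have "((1 + l * t) * (1 - l * s)) / ((1 - l * t) * (1 + l * s))
          = exp (ln ((1 + l * t) / (1 - l * t)) - ln ((1 + l * s) / (1 - l * s)))"
        using l by (simp add: exp_diff divide_pos_pos)
      then show ?thesis by (simp add: K_def)
    qed
    ultimately show ?thesis using pos by (meson mult_right_mono order.trans less_imp_le)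
  next
    case False
    then have "\<mu> * t \<le> \<mu> * s" using assms(1) by (intro mult_left_mono) auto
    then have "(1 + \<mu> * t) * (1 - \<mu> * s) \<le> 1 * ((1 - \<mu> * t) * (1 + \<mu> * s))"
      by (simp add: algebra_simps)
    also have "\<dots> \<le> K * ((1 - \<mu> * t) * (1 + \<mu> * s))"
      using pos by (intro mult_right_mono) (auto simp: K_def)
    finally show ?thesis .
  qed
  then show ?thesis by (simp add: K_def)
qed

text \<open>The quotient \<open>(p2\<^sup>2 a\<^sup>2 + q2\<^sup>2 b\<^sup>2) / (p1\<^sup>2 a\<^sup>2 + q1\<^sup>2 b\<^sup>2)\<close> is a weighted mean of \<open>(p2 / p1)\<^sup>2\<close> and
  \<open>(q2 / q1)\<^sup>2\<close>, so two of its values differ at most by the quotient of these two numbers.\<close>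

lemma diagonal_forms_ratio:
  fixes p1 q1 p2 q2 K :: real
  assumes K: "K \<ge> 1" and pos: "p1 > 0" "q1 > 0" "p2 > 0" "q2 > 0"
    and le: "q2 * p1 \<le> K * (p2 * q1)" "p2 * q1 \<le> K * (q2 * p1)"
  shows "(p2\<^sup>2 * a\<^sup>2 + q2\<^sup>2 * b\<^sup>2) * (p1\<^sup>2 * a'\<^sup>2 + q1\<^sup>2 * b'\<^sup>2)
    \<le> K\<^sup>2 * ((p2\<^sup>2 * a'\<^sup>2 + q2\<^sup>2 * b'\<^sup>2) * (p1\<^sup>2 * a\<^sup>2 + q1\<^sup>2 * b\<^sup>2))"
proof -
  have sq: "(x * c)\<^sup>2 \<le> K\<^sup>2 * (y * c)\<^sup>2" if "x \<le> K * y" "x \<ge> 0" for x y c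
  proof -
    have "x\<^sup>2 * c\<^sup>2 \<le> (K * y)\<^sup>2 * c\<^sup>2" using that by (intro mult_right_mono power_mono) auto
    then show ?thesis by (simp add: power_mult_distrib mult.assoc)
  qed
  have one: "x \<le> K * x" if "x \<ge> 0" for x using K that mult_right_mono[of 1 K x] by simp
  have "(p2 * p1 * (a * a'))\<^sup>2 \<le> K\<^sup>2 * (p2 * p1 * (a * a'))\<^sup>2" "(q2 * q1 * (b * b'))\<^sup>2 \<le> K\<^sup>2 * (q2 * q1 * (b * b'))\<^sup>2"
    using pos by (auto intro!: sq one)
  moreover have "(q2 * p1 * (b * a'))\<^sup>2 \<le> K\<^sup>2 * (p2 * q1 * (b * a'))\<^sup>2" "(p2 * q1 * (a * b'))\<^sup>2 \<le> K\<^sup>2 * (q2 * p1 * (a * b'))\<^sup>2"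
    using pos le by (auto intro!: sq)
  ultimately show ?thesis
    by (simp add: power_mult_distrib algebra_simps)
qed

section \<open>The identity map between parallel surfaces\<close>

locale marked_minimal_surface = minimal_surface_in_quotient +
  fixes X :: "'a topology" and A :: "'a chart set" and h :: "'a \<Rightarrow> mat2 set"
  assumes atlas: "oriented_smooth_atlas X A"
    and h_homeomorphic: "homeomorphic_map X (subtopology (hyp_quotient \<Gamma>) S) h"
    and h_immersion: "(U, \<phi>) \<in> A \<Longrightarrow> immersion_to_quotient \<Gamma> (\<phi> ` U) (h \<circ> inv_into U \<phi>)"
begin

lemma atlas_cover: "\<Union> (fst ` A) = topspace X"
  using atlas by (simp add: oriented_smooth_atlas_def)

lemma atlas_chart: "(W, \<alpha>) \<in> A \<Longrightarrow> is_chart X (W, \<alpha>)"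
  using atlas by (auto simp: oriented_smooth_atlas_def)

lemma surface_subset: "S \<subseteq> topspace (hyp_quotient \<Gamma>)"
  using surface by (simp add: closed_embedded_surface_def embedded_surface_def)

lemma h_in_S: "x \<in> topspace X \<Longrightarrow> h x \<in> S"
  using homeomorphic_imp_surjective_map[OF h_homeomorphic] surface_subset by auto

text \<open>Composing the projection to the quotient with \<open>\<alpha> \<circ> h\<^sup>-\<^sup>1\<close> gives a continuous inverse of the lift of
  \<open>h \<circ> \<alpha>\<^sup>-\<^sup>1\<close>.\<close>

lemma marking_lift:
  assumes W: "(W, \<alpha>) \<in> A" and x: "x \<in> W"
  obtains V Y where "\<alpha> x \<in> V" "V \<subseteq> \<alpha> ` W" "local_param St V Y"
    "\<And>w. w \<in> V \<Longrightarrow> orbit_of \<Gamma> (Y w) = h (inv_into W \<alpha> w)"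
proof -
  note chart = atlas_chart[OF W]
  have sub: "W \<subseteq> topspace X" by (rule chart_subset[OF chart])
  have "\<exists>V Y. \<alpha> x \<in> V \<and> V \<subseteq> \<alpha> ` W \<and> local_lift \<Gamma> (h \<circ> inv_into W \<alpha>) V Y \<and> (\<forall>w\<in>V. immersive_at Y w)"
    by (rule bspec[OF h_immersion[OF W, unfolded immersion_to_quotient_def] imageI[OF x]])
  then obtain V Y where V: "\<alpha> x \<in> V" "V \<subseteq> \<alpha> ` W" and lift: "local_lift \<Gamma> (h \<circ> inv_into W \<alpha>) V Y"
    and imm: "\<forall>w\<in>V. immersive_at Y w"
    by (elim exE conjE)
  have open_V: "open V" and smooth: "smooth_map_on V Y" and H3: "\<And>w. w \<in> V \<Longrightarrow> Y w \<in> H3"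
    and orbit: "\<And>w. w \<in> V \<Longrightarrow> orbit_of \<Gamma> (Y w) = h (inv_into W \<alpha> w)"
    using lift unfolding local_lift_def o_def by simp_all
  have inW: "inv_into W \<alpha> w \<in> W" if "w \<in> V" for w by (rule inv_into_into) (use that V(2) in blast)
  have \<alpha>_inv: "\<alpha> (inv_into W \<alpha> w) = w" if "w \<in> V" for w by (rule f_inv_into_f) (use that V(2) in blast)
  obtain k where "homeomorphic_maps X (subtopology (hyp_quotient \<Gamma>) S) h k"
    using h_homeomorphic homeomorphic_map_maps by blast
  then have k: "continuous_map (subtopology (hyp_quotient \<Gamma>) S) X k" and kh: "\<And>y. y \<in> topspace X \<Longrightarrow> k (h y) = y"
    by (auto simp: homeomorphic_maps_def)
  have k_orbit: "k (orbit_of \<Gamma> (Y w)) = inv_into W \<alpha> w" if "w \<in> V" for w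
    using orbit[OF that] kh inW[OF that] sub by auto
  have in_S: "orbit_of \<Gamma> (Y w) \<in> S" if "w \<in> V" for w
    using orbit[OF that] h_in_S inW[OF that] sub by auto
  have "continuous_map (top_of_set (Y ` V)) (hyp_quotient \<Gamma>) (orbit_of \<Gamma>)"
    by (rule continuous_map_from_subtopology_mono[OF continuous_map_orbit]) (use H3 in auto)
  then have "continuous_map (top_of_set (Y ` V)) (subtopology (hyp_quotient \<Gamma>) S) (orbit_of \<Gamma>)"
    by (rule continuous_map_into_subtopology) (use in_S in auto)
  from continuous_map_compose[OF this k]
  have "continuous_map (top_of_set (Y ` V)) (subtopology X W) (k \<circ> orbit_of \<Gamma>)"
    by (rule continuous_map_into_subtopology) (use k_orbit inW in auto)
  from continuous_map_compose[OF this chart_continuous[OF chart]]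
  have cont: "continuous_on (Y ` V) (\<alpha> \<circ> (k \<circ> orbit_of \<Gamma>))"
    by simp
  have "local_param St V Y"
    by (rule local_param_of_injective_immersion[OF open_V smooth _ bspec[OF imm] cont])
      (use H3 in_S k_orbit \<alpha>_inv in \<open>auto simp: preimage_in_H3_def\<close>)
  then show ?thesis using that V orbit by blast
qed

text \<open>Conformality is stated for some lift of the immersion to \<open>H3\<close>. The parallel lift of the surface,
  composed with \<open>\<alpha> \<circ> \<phi>\<^sup>-\<^sup>1\<close>, is another lift of the same map, and the metric does not depend on
  the lift.\<close>

lemma isothermal_chart_metric:
  assumes U: "(U, \<phi>) \<in> induced_conformal_structure X A \<Gamma> (parallel_map \<nu> r \<circ> h)"
    and W: "(W, \<alpha>) \<in> A" and x: "x \<in> U" "x \<in> W"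
    and V: "\<alpha> x \<in> V" "V \<subseteq> \<alpha> ` W" and lp: "local_param St V Y"
    and orbit: "\<And>w. w \<in> V \<Longrightarrow> orbit_of \<Gamma> (Y w) = h (inv_into W \<alpha> w)"
  defines "D \<equiv> \<lambda>v. frechet_derivative (parallel_point \<nu> r \<circ> Y) (at (\<alpha> x))
      (frechet_derivative (\<alpha> \<circ> inv_into U \<phi>) (at (\<phi> x)) v)"
  obtains c where "c > 0" "\<And>v. mink (D v) (D v) = c * (cmod v)\<^sup>2"
proof -
  have compat: "compatible_chart X A U \<phi>"
    and conf: "conformal_immersion_to_quotient \<Gamma> (\<phi> ` U) (parallel_map \<nu> r \<circ> h \<circ> inv_into U \<phi>)"
    using U by (auto simp: induced_conformal_structure_def compatible_chart_def)
  note chart = compatible_is_chart[OF compat] and chartW = atlas_chart[OF W]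
  have inv: "inv_into U \<phi> (\<phi> y) = y" if "y \<in> U" for y using that chart_inj[OF chart] by simp
  have invW: "inv_into W \<alpha> (\<alpha> y) = y" if "y \<in> W" for y using that chart_inj[OF chartW] by simp
  have "\<exists>V Y. \<phi> x \<in> V \<and> V \<subseteq> \<phi> ` U \<and> local_lift \<Gamma> (parallel_map \<nu> r \<circ> h \<circ> inv_into U \<phi>) V Y
      \<and> (\<forall>w\<in>V. conformal_at Y w)"
    by (rule bspec[OF conf[unfolded conformal_immersion_to_quotient_def] imageI[OF x(1)]])
  then obtain V1 Y1 where V1: "\<phi> x \<in> V1" "V1 \<subseteq> \<phi> ` U"
    and lift: "local_lift \<Gamma> (parallel_map \<nu> r \<circ> h \<circ> inv_into U \<phi>) V1 Y1"
    and cf: "\<forall>w\<in>V1. conformal_at Y1 w"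
    by (elim exE conjE)
  have open_V1: "open V1" and smooth: "smooth_map_on V1 Y1"
    and orbit1: "\<And>w. w \<in> V1 \<Longrightarrow> orbit_of \<Gamma> (Y1 w) = parallel_map \<nu> r (h (inv_into U \<phi> w))"
    using lift unfolding local_lift_def o_def by simp_all
  have Y1: "Ck_on (Suc 0) Y1 V1" by (rule smooth_map_on_imp_C1[OF smooth])
  let ?\<tau> = "\<alpha> \<circ> inv_into U \<phi>" and ?P = "parallel_point \<nu> r \<circ> Y"
  have \<tau>: "Ck_on (Suc 0) ?\<tau> (\<phi> ` (U \<inter> W))" by (rule compatible_chartD(3)[OF compat W])
  have open_V: "open V" using lp by (simp add: local_param_def)
  have "openin X W" using chartW by (simp add: is_chart_def)
  then have open_UW: "open (\<phi> ` (U \<inter> W))" by (rule chart_open_image[OF chart])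
  define N where "N = V1 \<inter> (\<phi> ` (U \<inter> W) \<inter> ?\<tau> -` V)"
  have N: "open N"
    unfolding N_def by (intro open_Int open_V1 continuous_open_preimage C1_on_continuous[OF \<tau>] open_UW open_V)
  have \<tau>x: "?\<tau> (\<phi> x) = \<alpha> x" using x by (simp add: inv)
  have xN: "\<phi> x \<in> N" unfolding N_def using V1(1) x V(1) \<tau>x by auto
  have \<tau>N: "Ck_on (Suc 0) ?\<tau> N" by (rule Ck_on_subset[OF \<tau>]) (auto simp: N_def)
  have Y1N: "Ck_on (Suc 0) Y1 N" by (rule Ck_on_subset[OF Y1]) (auto simp: N_def)
  have P: "Ck_on (Suc 0) ?P V" by (rule C1_parallel_point(1)[OF lp])
  have PN: "Ck_on (Suc 0) (?P \<circ> ?\<tau>) N" by (rule C1_on_compose[OF \<tau>N P]) (auto simp: N_def)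
  have "orbit_of \<Gamma> (Y1 w) = orbit_of \<Gamma> ((?P \<circ> ?\<tau>) w)" if "w \<in> N" for w
  proof -
    have "w \<in> \<phi> ` (U \<inter> W)" using that unfolding N_def by blast
    then obtain y where y: "w = \<phi> y" "y \<in> U" "y \<in> W" by blast
    have \<tau>w: "?\<tau> w = \<alpha> y" and "\<alpha> y \<in> V" using that y by (auto simp: N_def inv)
    then have "orbit_of \<Gamma> (Y (\<alpha> y)) = h y" and "Y (\<alpha> y) \<in> St"
      using orbit local_param_in_St[OF lp] invW[OF y(3)] by auto
    then have "orbit_of \<Gamma> (?P (\<alpha> y)) = parallel_map \<nu> r (h y)"
      using parallel_map_orbit[of "Y (\<alpha> y)" r] by simp
    then show ?thesis using orbit1[of w] that y \<tau>w by (simp add: N_def inv)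
  qed
  from lifts_isometric[OF N Y1N PN this xN]
  have iso: "mink (frechet_derivative Y1 (at (\<phi> x)) u) (frechet_derivative Y1 (at (\<phi> x)) v)
      = mink (frechet_derivative (?P \<circ> ?\<tau>) (at (\<phi> x)) u) (frechet_derivative (?P \<circ> ?\<tau>) (at (\<phi> x)) v)" for u v .
  have D: "frechet_derivative (?P \<circ> ?\<tau>) (at (\<phi> x)) v = D v" for v
    using frechet_derivative_comp_apply[of ?P ?\<tau> "\<phi> x" v] C1_on_differentiable[OF P V(1)]
      C1_on_differentiable[OF \<tau>N xN] \<tau>x by (simp add: D_def)
  let ?E = "frechet_derivative Y1 (at (\<phi> x))"
  define c where "c = mink (?E 1) (?E 1)"
  have c: "c > 0" "mink (?E \<i>) (?E \<i>) = c" "mink (?E 1) (?E \<i>) = 0" "mink (?E \<i>) (?E 1) = 0"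
    using bspec[OF cf V1(1)] by (auto simp: conformal_at_def Let_def c_def mink_commute)
  interpret M: bounded_bilinear mink by (rule bounded_bilinear_mink)
  have lin: "linear ?E" by (rule linear_frechet_derivative[OF C1_on_differentiable[OF Y1 V1(1)]])
  have "mink (D v) (D v) = c * (cmod v)\<^sup>2" for v
  proof -
    have "v = Re v *\<^sub>R 1 + Im v *\<^sub>R \<i>" by (simp add: complex_eq_iff)
    then have "?E v = ?E (Re v *\<^sub>R 1 + Im v *\<^sub>R \<i>)" by simp
    also have "\<dots> = Re v *\<^sub>R ?E 1 + Im v *\<^sub>R ?E \<i>" by (simp add: linear_add[OF lin] linear_scale[OF lin])
    finally have Ev: "?E v = Re v *\<^sub>R ?E 1 + Im v *\<^sub>R ?E \<i>" .
    have "mink (?E v) (?E v) = c * (cmod v)\<^sup>2"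
      unfolding Ev M.add_left M.add_right M.scaleR_left M.scaleR_right c c_def[symmetric] cmod_power2
      by (simp add: power2_eq_square algebra_simps)
    then show ?thesis using iso D by simp
  qed
  then show ?thesis using that c(1) by blast
qed

text \<open>In the coordinates of \<open>\<alpha>\<close>, the metric of the first surface is a multiple of the pullback of \<open>\<bar>dz\<bar>\<^sup>2\<close>
  by \<open>\<phi>\<close>, and that of the second a multiple of the pullback by \<open>\<psi>\<close>. So the transition map
  distorts circles as much as the quotient of the two metrics varies with the direction.\<close>

lemma transition_stretch:
  assumes U: "(U, \<phi>) \<in> induced_conformal_structure X A \<Gamma> (parallel_map \<nu> r1 \<circ> h)"
    and V: "(V, \<psi>) \<in> induced_conformal_structure X A \<Gamma> (parallel_map \<nu> r2 \<circ> h)"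
    and x: "x \<in> U" "x \<in> V"
    and l: "l \<le> 1" "\<And>p k. p \<in> St \<Longrightarrow> k \<in> principal_curvatures \<Gamma> S \<nu> p \<Longrightarrow> k \<le> l"
    and uv: "cmod u = cmod v"
  defines "T \<equiv> frechet_derivative (\<psi> \<circ> inv_into U \<phi>) (at (\<phi> x))"
    and "K \<equiv> exp \<bar>ln ((1 + l * tanh r2) / (1 - l * tanh r2)) - ln ((1 + l * tanh r1) / (1 - l * tanh r1))\<bar>"
  shows "cmod (T u) \<le> K * cmod (T v)"
proof -
  have \<phi>: "compatible_chart X A U \<phi>" and \<psi>: "compatible_chart X A V \<psi>"
    using U V by (auto simp: induced_conformal_structure_def compatible_chart_def)
  have "x \<in> \<Union> (fst ` A)"
    using atlas_cover chart_subset[OF compatible_is_chart[OF \<phi>]] x by blast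
  then obtain W \<alpha> where W: "(W, \<alpha>) \<in> A" "x \<in> W" by auto
  obtain O' Y where O': "\<alpha> x \<in> O'" "O' \<subseteq> \<alpha> ` W" and lp: "local_param St O' Y"
    and orbit: "\<And>w. w \<in> O' \<Longrightarrow> orbit_of \<Gamma> (Y w) = h (inv_into W \<alpha> w)"
    using marking_lift[OF W] by blast
  let ?D = "\<lambda>r. frechet_derivative (parallel_point \<nu> r \<circ> Y) (at (\<alpha> x))"
  let ?T1 = "frechet_derivative (\<alpha> \<circ> inv_into U \<phi>) (at (\<phi> x))"
  let ?T2 = "frechet_derivative (\<alpha> \<circ> inv_into V \<psi>) (at (\<psi> x))"
  obtain c1 where c1: "c1 > 0" "\<And>v. mink (?D r1 (?T1 v)) (?D r1 (?T1 v)) = c1 * (cmod v)\<^sup>2"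
    using isothermal_chart_metric[OF U W(1) x(1) W(2) O' lp orbit] by blast
  obtain c2 where c2: "c2 > 0" "\<And>v. mink (?D r2 (?T2 v)) (?D r2 (?T2 v)) = c2 * (cmod v)\<^sup>2"
    using isothermal_chart_metric[OF V W(1) x(2) W(2) O' lp orbit] by blast
  have T: "?T2 (T v) = ?T1 v" for v
    unfolding T_def by (rule transition_factorization(3)[OF \<phi> \<psi> W(1) x W(2)])
  obtain \<mu> a b where \<mu>: "\<mu> \<ge> 0" "\<mu> \<in> principal_curvatures \<Gamma> S \<nu> (Y (\<alpha> x))"
    and metric: "\<And>r v. mink (?D r v) (?D r v) = (cosh r)\<^sup>2 * ((1 - \<mu> * tanh r)\<^sup>2 * (a v)\<^sup>2 + (1 + \<mu> * tanh r)\<^sup>2 * (b v)\<^sup>2)"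
    using parallel_metric[OF lp O'(1)] by blast
  have \<mu>l: "\<mu> \<le> l" by (rule l(2)[OF local_param_in_St[OF lp O'(1)] \<mu>(2)])
  have tanh: "\<bar>tanh r\<bar> < 1" for r :: real by (simp add: abs_less_iff tanh_real_lt_1 tanh_real_gt_neg1 minus_less_iff)
  have pos: "1 - \<mu> * tanh r > 0" "1 + \<mu> * tanh r > 0" for r
  proof -
    have "\<bar>\<mu> * tanh r\<bar> < 1"
      using mult_left_le_one_le[of "\<bar>tanh r\<bar>" \<mu>] \<mu>(1) \<mu>l l(1) tanh[of r] by (simp add: abs_mult)
    then show "1 - \<mu> * tanh r > 0" "1 + \<mu> * tanh r > 0" by auto
  qed
  have K: "K \<ge> 1" by (simp add: K_def)
  have le1: "(1 + \<mu> * tanh r2) * (1 - \<mu> * tanh r1) \<le> K * ((1 - \<mu> * tanh r2) * (1 + \<mu> * tanh r1))"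
    unfolding K_def by (rule dilatation_exponent_mono[OF \<mu>(1) \<mu>l l(1) tanh tanh])
  have le2: "(1 - \<mu> * tanh r2) * (1 + \<mu> * tanh r1) \<le> K * ((1 + \<mu> * tanh r2) * (1 - \<mu> * tanh r1))"
    using dilatation_exponent_mono[OF \<mu>(1) \<mu>l l(1) tanh tanh, of r1 r2]
    by (simp add: K_def abs_minus_commute mult.commute)
  define g where "g r w = (1 - \<mu> * tanh r)\<^sup>2 * (a w)\<^sup>2 + (1 + \<mu> * tanh r)\<^sup>2 * (b w)\<^sup>2" for r w
  have g1: "(cosh r1)\<^sup>2 * g r1 (?T1 w) = c1 * (cmod w)\<^sup>2" for w
    using c1(2)[of w] metric[of r1 "?T1 w"] by (simp add: g_def)
  have g2: "(cosh r2)\<^sup>2 * g r2 (?T1 w) = c2 * (cmod (T w))\<^sup>2" for w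
    using c2(2)[of "T w"] metric[of r2 "?T1 w"] by (simp add: g_def T)
  have "g r2 (?T1 u) * g r1 (?T1 v) \<le> K\<^sup>2 * (g r2 (?T1 v) * g r1 (?T1 u))"
    unfolding g_def by (rule diagonal_forms_ratio[OF K pos pos le1 le2])
  then have "((cosh r1)\<^sup>2 * (cosh r2)\<^sup>2) * (g r2 (?T1 u) * g r1 (?T1 v))
      \<le> ((cosh r1)\<^sup>2 * (cosh r2)\<^sup>2) * (K\<^sup>2 * (g r2 (?T1 v) * g r1 (?T1 u)))"
    by (rule mult_left_mono) simp
  then have "((cosh r2)\<^sup>2 * g r2 (?T1 u)) * ((cosh r1)\<^sup>2 * g r1 (?T1 v))
      \<le> K\<^sup>2 * (((cosh r2)\<^sup>2 * g r2 (?T1 v)) * ((cosh r1)\<^sup>2 * g r1 (?T1 u)))"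
    by (simp add: mult_ac)
  then have main: "(c1 * c2 * (cmod v)\<^sup>2) * (cmod (T u))\<^sup>2 \<le> (c1 * c2 * (cmod v)\<^sup>2) * (K * cmod (T v))\<^sup>2"
    unfolding g1 g2 uv by (simp add: power_mult_distrib mult_ac)
  have lin: "linear T"
    using C1_on_differentiable[OF C1_transition[OF \<phi> \<psi> atlas_cover]] x
    unfolding T_def by (intro linear_frechet_derivative) auto
  show ?thesis
  proof (cases "v = 0")
    case True
    then show ?thesis using uv linear_0[OF lin] by simp
  next
    case False
    then have "c1 * c2 * (cmod v)\<^sup>2 > 0" using c1(1) c2(1) by simp
    with main have "(cmod (T u))\<^sup>2 \<le> (K * cmod (T v))\<^sup>2" by (rule mult_left_le_imp_le)
    then show ?thesis by (rule power2_le_imp_le) (use K in simp)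
  qed
qed

lemma identity_quasiconformal:
  assumes l: "l \<le> 1" "\<And>p k. p \<in> St \<Longrightarrow> k \<in> principal_curvatures \<Gamma> S \<nu> p \<Longrightarrow> k \<le> l"
  shows "quasiconformal_map X (induced_conformal_structure X A \<Gamma> (parallel_map \<nu> r1 \<circ> h))
    (induced_conformal_structure X A \<Gamma> (parallel_map \<nu> r2 \<circ> h))
    (exp \<bar>ln ((1 + l * tanh r2) / (1 - l * tanh r2)) - ln ((1 + l * tanh r1) / (1 - l * tanh r1))\<bar>) id"
  unfolding quasiconformal_map_def
proof (intro conjI ballI)
  show "homeomorphic_map X X id" by (simp add: homeomorphic_map_id)
  let ?K = "exp \<bar>ln ((1 + l * tanh r2) / (1 - l * tanh r2)) - ln ((1 + l * tanh r1) / (1 - l * tanh r1))\<bar>"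
  show K: "1 \<le> ?K" by simp
  have "quasiconformal_on ?K (\<phi> ` {x \<in> U. id x \<in> V}) (\<psi> \<circ> id \<circ> inv_into U \<phi>)"
    if U: "(U, \<phi>) \<in> induced_conformal_structure X A \<Gamma> (parallel_map \<nu> r1 \<circ> h)"
      and V: "(V, \<psi>) \<in> induced_conformal_structure X A \<Gamma> (parallel_map \<nu> r2 \<circ> h)" for U \<phi> V \<psi>
  proof -
    have \<phi>: "compatible_chart X A U \<phi>" and \<psi>: "compatible_chart X A V \<psi>"
      using U V by (auto simp: induced_conformal_structure_def compatible_chart_def)
    have "quasiconformal_on ?K (\<phi> ` (U \<inter> V)) (\<psi> \<circ> inv_into U \<phi>)"
    proof (rule C1_on_imp_quasiconformal_on[OF C1_transition[OF \<phi> \<psi> atlas_cover] homeomorphism_transition[OF \<phi> \<psi> atlas_cover] K])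
      fix z assume "z \<in> \<phi> ` (U \<inter> V)"
      then obtain x where x: "z = \<phi> x" "x \<in> U" "x \<in> V" by blast
      then have "x \<in> \<Union> (fst ` A)" using atlas_cover chart_subset[OF compatible_is_chart[OF \<phi>]] by blast
      then obtain W \<alpha> where "(W, \<alpha>) \<in> A" "x \<in> W" by auto
      from transition_factorization(2)[OF \<phi> \<psi> this(1) x(2,3) this(2)]
      show "Im (cnj (frechet_derivative (\<psi> \<circ> inv_into U \<phi>) (at z) 1) * frechet_derivative (\<psi> \<circ> inv_into U \<phi>) (at z) \<i>) > 0"
        by (simp add: x(1))
      fix u v assume "cmod u = cmod v"
      from transition_stretch[OF U V x(2,3) l this]
      show "cmod (frechet_derivative (\<psi> \<circ> inv_into U \<phi>) (at z) u) \<le> ?K * cmod (frechet_derivative (\<psi> \<circ> inv_into U \<phi>) (at z) v)"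
        by (simp add: x(1))
    qed
    moreover have "{x \<in> U. id x \<in> V} = U \<inter> V" by auto
    ultimately show ?thesis by simp
  qed
  then show "case c1 of (U, \<phi>) \<Rightarrow> \<forall>(V, \<psi>)\<in>induced_conformal_structure X A \<Gamma> (parallel_map \<nu> r2 \<circ> h).
      quasiconformal_on ?K (\<phi> ` {x \<in> U. id x \<in> V}) (\<psi> \<circ> id \<circ> inv_into U \<phi>)"
    if "c1 \<in> induced_conformal_structure X A \<Gamma> (parallel_map \<nu> r1 \<circ> h)" for c1
    using that by (cases c1) (simp del: id_apply o_id add: case_prod_unfold)
qed

lemma parallel_map_zero: "m \<in> S \<Longrightarrow> parallel_map \<nu> 0 m = m"
proof -
  assume m: "m \<in> S"
  then obtain p where p: "p \<in> H3" "m = orbit_of \<Gamma> p"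
    using surface_subset by (auto simp: topspace_hyp_quotient)
  then have "p \<in> St" using m by (simp add: preimage_in_H3_def)
  from parallel_map_orbit[OF this, of 0] p(2) show ?thesis by (simp add: parallel_point_def)
qed

end

lemma induced_conformal_structure_cong:
  assumes "\<And>x. x \<in> topspace X \<Longrightarrow> F x = G x"
  shows "induced_conformal_structure X A \<Gamma> F = induced_conformal_structure X A \<Gamma> G"
proof -
  have "conformal_immersion_to_quotient \<Gamma> (\<phi> ` U) (F \<circ> inv_into U \<phi>)
    \<longleftrightarrow> conformal_immersion_to_quotient \<Gamma> (\<phi> ` U) (G \<circ> inv_into U \<phi>)"
    if "oriented_smooth_atlas X (insert (U, \<phi>) A)" for U \<phi>
  proof -
    have "U \<subseteq> topspace X" using that by (auto simp: oriented_smooth_atlas_def)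
    then have FG: "F (inv_into U \<phi> w) = G (inv_into U \<phi> w)" if "w \<in> \<phi> ` U" for w
      by (intro assms subsetD[OF _ inv_into_into[OF that]])
    have eq: "local_lift \<Gamma> (F \<circ> inv_into U \<phi>) V Y \<longleftrightarrow> local_lift \<Gamma> (G \<circ> inv_into U \<phi>) V Y"
      if "V \<subseteq> \<phi> ` U" for V Y
    proof -
      have "(F \<circ> inv_into U \<phi>) w = (G \<circ> inv_into U \<phi>) w" if "w \<in> V" for w
        using FG[of w] that \<open>V \<subseteq> \<phi> ` U\<close> by auto
      then show ?thesis unfolding local_lift_def by (simp cong: ball_cong)
    qed
    show ?thesis unfolding conformal_immersion_to_quotient_def
      by (intro ball_cong refl ex_cong1 conj_cong) (erule eq)
  qed
  then show ?thesis unfolding induced_conformal_structure_def by auto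
qed

theorem theorem1p2:
  fixes X :: "'a topology" and A :: "'a chart set" and g :: nat
    and \<Gamma> :: "(mat2 \<Rightarrow> mat2) set"
    and \<Psi> :: "'a \<times> real \<Rightarrow> mat2 set"
    and S :: "mat2 set set" and \<nu> :: "mat2 \<Rightarrow> mat2" and h :: "'a \<Rightarrow> mat2 set"
    and lam :: "mat2 set \<Rightarrow> real" and lam0 :: real
    and \<sigma> :: "real \<Rightarrow> 'a chart set"
  assumes "closed_oriented_surface X A g" and "g \<ge> 2"
    and "almost_fuchsian \<Gamma>" and "\<not> fuchsian \<Gamma>"
    and "homeomorphic_map (prod_topology X euclideanreal) (hyp_quotient \<Gamma>) \<Psi>"
    and "almost_fuchsian_surface \<Gamma> S \<nu>"
    and "marking X A \<Gamma> \<Psi> S h"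
    and "\<And>p. p \<in> preimage_in_H3 \<Gamma> S \<Longrightarrow>
           principal_curvatures \<Gamma> S \<nu> p = {lam (orbit_of \<Gamma> p), - lam (orbit_of \<Gamma> p)}"
    and "\<And>z. z \<in> S \<Longrightarrow> 0 \<le> lam z \<and> lam z < 1"
    and "lam0 = (SUP z\<in>S. lam z)"
    and "\<And>r. \<sigma> r = induced_conformal_structure X A \<Gamma> (parallel_map \<nu> r \<circ> h)"
  shows "(\<forall>r. teichmueller_dist X (induced_conformal_structure X A \<Gamma> h) (\<sigma> r)
            \<le> 1 / 2 * \<bar>ln ((1 + lam0 * tanh r) / (1 - lam0 * tanh r))\<bar>) \<and>
         (\<forall>r1 r2. teichmueller_dist X (\<sigma> r1) (\<sigma> r2)
            \<le> 1 / 2 * \<bar>ln ((1 + lam0 * tanh r2) / (1 - lam0 * tanh r2))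
                     - ln ((1 + lam0 * tanh r1) / (1 - lam0 * tanh r1))\<bar>)"
proof -
  interpret marked_minimal_surface \<Gamma> S \<nu> X A h
    using assms(1,3,6,7)
    by unfold_locales
      (auto simp: almost_fuchsian_def quasi_fuchsian_def almost_fuchsian_surface_def
        closed_oriented_surface_def marking_def)
  have "S \<noteq> {}" using surface by (simp add: closed_embedded_surface_def)
  then have "lam0 \<le> 1" unfolding assms(10) using assms(9) by (intro cSUP_least) (auto intro: less_imp_le)
  have "bdd_above (lam ` S)" using assms(9) by (auto intro!: bdd_aboveI[of _ 1] less_imp_le)
  then have "lam z \<le> lam0" if "z \<in> S" for z
    unfolding assms(10) using that by (intro cSUP_upper)
  then have curv: "k \<le> lam0" if "p \<in> St" "k \<in> principal_curvatures \<Gamma> S \<nu> p" for p k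
    using assms(8)[OF that(1)] assms(9)[of "orbit_of \<Gamma> p"] that by (fastforce simp: preimage_in_H3_def)
  have dist: "teichmueller_dist X (\<sigma> r1) (\<sigma> r2)
            \<le> 1 / 2 * \<bar>ln ((1 + lam0 * tanh r2) / (1 - lam0 * tanh r2))
                     - ln ((1 + lam0 * tanh r1) / (1 - lam0 * tanh r1))\<bar>" for r1 r2
  proof -
    have "quasiconformal_map X (\<sigma> r1) (\<sigma> r2) (exp \<bar>ln ((1 + lam0 * tanh r2) / (1 - lam0 * tanh r2))
        - ln ((1 + lam0 * tanh r1) / (1 - lam0 * tanh r1))\<bar>) id"
      unfolding assms(11) by (rule identity_quasiconformal[OF \<open>lam0 \<le> 1\<close> curv])
    from teichmueller_dist_le_identity[OF this] show ?thesis by (simp only: ln_exp)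
  qed
  (* The first estimate is the second one with r1 = 0, since the surface at distance 0 is S itself. *)
  have "induced_conformal_structure X A \<Gamma> h = \<sigma> 0"
    unfolding assms(11) by (rule induced_conformal_structure_cong) (simp add: parallel_map_zero h_in_S)
  then show ?thesis using dist dist[of 0] by simp
qed

end
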